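(* Let $d\geqslant 1$ and let $\mathcal{S}=(A_n)_{n\in\mathbb{N}}$ be a sequence of $d\times d$ integer matrices such that for some real $\tau\geqslant 1/d$ and all $N\in\mathbb{N}$, $$\frac1N\sum_{n=1}^N\|A_n\|\ll N^\tau,$$ and such that $A_n-A_m$ is invertible for all $n\neq m$. Let $\mathcal{E}_{\mathcal{S}}$ be the set of points $\mathbf{x}\in[0,1]^d$ (viewed as row vectors) such that the sequence $\mathbf{x}A_n$, $n=1,2,\ldots$, is not uniformly distributed modulo $1$ in $[0,1)^d$. Then $$\dim\mathcal{E}_{\mathcal{S}}\leqslant d-1/\tau,$$ where $\dim$ denotes Hausdorff dimension.
   Context: For a $d\times d$ matrix $A$, $\|A\|=\sup\{\|\mathbf{x}A\|:\ \mathbf{x}\in\mathbb{R}^d,\ \|\mathbf{x}\|=1\}$ is the operator norm, with $\|\cdot\|$ the Euclidean norm. The notation $U\ll V$ means $|U|\leqslant cV$ for some constant $c>0$ independent of $N$. *)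

theory Defs
  imports "HOL-Analysis.Analysis"
begin

definition row_opnorm :: "real ^ 'n ^ 'm \<Rightarrow> real" where
  "row_opnorm A = (SUP x\<in>{x :: real ^ 'm. norm x = 1}. norm (x v* A))"

text \<open>
  Sequences are indexed from 1; the value of \<open>u\<close> at 0 plays no role.
\<close>

definition uniformly_distributed_mod1 :: "(nat \<Rightarrow> real ^ 'n) \<Rightarrow> bool" where
  "uniformly_distributed_mod1 u \<longleftrightarrow>
     (\<forall>a b :: real ^ 'n. (\<forall>i. 0 \<le> a $ i \<and> a $ i < b $ i \<and> b $ i \<le> 1) \<longrightarrow>
        (\<lambda>N. real (card {n \<in> {1..N}. \<forall>i. frac (u n $ i) \<in> {a $ i..<b $ i}}) / real N)
          \<longlonglongrightarrow> (\<Prod>i\<in>UNIV. b $ i - a $ i))"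

text \<open>
  The \<open>s\<close>-th power of the diameter with the conventions of Hausdorff measure: the empty set
  contributes 0, and for \<open>s = 0\<close> every nonempty set contributes 1 (whereas \<open>0 powr 0 = 0\<close>).
\<close>

definition diam_power :: "real \<Rightarrow> 'a::metric_space set \<Rightarrow> ennreal" where
  "diam_power s U =
     (if U = {} then 0 else if s = 0 then 1 else ennreal (diameter U powr s))"

text \<open>
  Boundedness of the covering sets is required explicitly because \<^const>\<open>diameter\<close> is
  real-valued and carries no information on unbounded sets.
\<close>

definition hausdorff_premeasure :: "real \<Rightarrow> real \<Rightarrow> 'a::metric_space set \<Rightarrow> ennreal" where
  "hausdorff_premeasure s \<delta> E =
     (INF U\<in>{U :: nat \<Rightarrow> 'a set. E \<subseteq> (\<Union>i. U i) \<and> (\<forall>i. bounded (U i) \<and> diameter (U i) \<le> \<delta>)}.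
        \<Sum>i. diam_power s (U i))"

definition hausdorff_measure :: "real \<Rightarrow> 'a::metric_space set \<Rightarrow> ennreal" where
  "hausdorff_measure s E = (SUP \<delta>\<in>{0<..}. hausdorff_premeasure s \<delta> E)"

definition hausdorff_dim :: "'a::metric_space set \<Rightarrow> ereal" where
  "hausdorff_dim E = (INF s\<in>{s. 0 \<le> s \<and> hausdorff_measure s E = 0}. ereal s)"

definition exceptional_set :: "(nat \<Rightarrow> real ^ 'n ^ 'n) \<Rightarrow> (real ^ 'n) set" where
  "exceptional_set A =
     {x. (\<forall>i. 0 \<le> x $ i \<and> x $ i \<le> 1) \<and> \<not> uniformly_distributed_mod1 (\<lambda>n. x v* A n)}"

end

theory Submission
  imports Defs
begin

text \<open>
  By Weyl's criterion an exceptional point \<open>x\<close> has, for some nonzero integer vector \<open>h\<close>, Weyl means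
  \<open>W\<^sub>N(x) = (1/N) \<Sum>n\<le>N. e(x \<bullet> v\<^sub>n)\<close>, \<open>v\<^sub>n = A\<^sub>n h\<close>, that do not tend to 0. The \<open>v\<^sub>n\<close> are distinct
  integer vectors, so \<open>W\<^sub>N\<close> has mean square \<open>1/N\<close> over the unit cube, and \<open>W\<^sub>N\<close> is Lipschitz with
  constant \<open>O(N\<^bsup>\<tau>\<^esup>)\<close>. Hence if \<open>|W\<^sub>N| \<ge> \<epsilon>\<close> somewhere on a cell of side \<open>\<asymp> N\<^bsup>-\<tau>\<^esup>\<close>, then \<open>|W\<^sub>N| \<ge> \<epsilon>/2\<close> on
  the whole cell, and there are only \<open>O(N\<^bsup>\<tau>d - 1\<^esup>)\<close> such cells. The sums of the \<open>s\<close>-th powers of their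
  diameters are \<open>O(N\<^bsup>\<tau>(d - s) - 1\<^esup>)\<close>, with a negative exponent when \<open>s > d - 1/\<tau>\<close>; along \<open>N = k^M\<close> with
  \<open>M\<close> large they are summable in \<open>k\<close>. This sparse sequence suffices because consecutive terms have
  ratio tending to 1.
\<close>

subsection \<open>Cesaro means\<close>

definition cesaro_mean :: "(nat \<Rightarrow> 'a::real_vector) \<Rightarrow> nat \<Rightarrow> 'a" where
  "cesaro_mean a N = (\<Sum>n=1..N. a n) /\<^sub>R real N"

lemma cesaro_mean_add: "cesaro_mean (\<lambda>n. a n + b n) N = cesaro_mean a N + cesaro_mean b N"
  by (simp add: cesaro_mean_def sum.distrib scaleR_add_right)

lemma cesaro_mean_diff: "cesaro_mean (\<lambda>n. a n - b n) N = cesaro_mean a N - cesaro_mean b N"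
  by (simp add: cesaro_mean_def sum_subtractf scaleR_diff_right)

lemma cesaro_mean_const: "N \<ge> 1 \<Longrightarrow> cesaro_mean (\<lambda>_. c) N = c"
  by (simp add: cesaro_mean_def sum_constant_scaleR)

lemma linear_cesaro_mean: "linear T \<Longrightarrow> T (cesaro_mean a N) = cesaro_mean (\<lambda>n. T (a n)) N"
  by (simp add: cesaro_mean_def linear_sum linear_scale)

lemma cesaro_mean_mono:
  fixes a b :: "nat \<Rightarrow> real"
  shows "(\<And>n. n \<ge> 1 \<Longrightarrow> a n \<le> b n) \<Longrightarrow> cesaro_mean a N \<le> cesaro_mean b N"
  by (auto simp: cesaro_mean_def intro!: mult_left_mono sum_mono)

lemma norm_cesaro_mean_le:
  assumes "\<And>n. norm (a n) \<le> B"
  shows "norm (cesaro_mean a N) \<le> B"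
proof (cases "N = 0")
  case True
  then show ?thesis
    using order_trans[OF norm_ge_zero assms] by (simp add: cesaro_mean_def)
next
  case False
  have "norm (\<Sum>n=1..N. a n) \<le> real N * B"
    using sum_norm_bound[of "{1..N}" a B] assms by simp
  with False show ?thesis
    by (simp add: cesaro_mean_def field_simps)
qed

lemma norm_cesaro_mean_le_earlier_mean:
  assumes bound: "\<And>n. norm (a n) \<le> B" and "1 \<le> m" "m \<le> N"
  shows "norm (cesaro_mean a N) \<le> norm (cesaro_mean a m) + B * (real N / real m - 1)"
proof -
  have "(\<Sum>n=1..N. a n) = (\<Sum>n=1..m. a n) + (\<Sum>n=Suc m..N. a n)"
    using sum.ub_add_nat[of 1 m a "N - m"] \<open>m \<le> N\<close> by simp
  then have "norm (\<Sum>n=1..N. a n) \<le> norm (\<Sum>n=1..m. a n) + norm (\<Sum>n=Suc m..N. a n)"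
    by (simp add: norm_triangle_ineq)
  also have "norm (\<Sum>n=Suc m..N. a n) \<le> B * (real N - real m)"
    using sum_norm_bound[of "{Suc m..N}" a B] bound \<open>m \<le> N\<close> by (simp add: of_nat_diff mult.commute)
  finally have sum_le: "norm (\<Sum>n=1..N. a n) \<le> norm (\<Sum>n=1..m. a n) + B * (real N - real m)"
    by simp
  have "norm (cesaro_mean a N) = norm (\<Sum>n=1..N. a n) / real N"
    by (simp add: cesaro_mean_def divide_inverse_commute)
  also have "\<dots> \<le> norm (\<Sum>n=1..N. a n) / real m"
    using assms(2,3) by (intro divide_left_mono) auto
  also have "\<dots> \<le> (norm (\<Sum>n=1..m. a n) + B * (real N - real m)) / real m"
    using sum_le by (rule divide_right_mono) simp
  also have "\<dots> = norm (cesaro_mean a m) + B * (real N / real m - 1)"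
    using \<open>1 \<le> m\<close> by (simp add: cesaro_mean_def field_simps)
  finally show ?thesis .
qed

lemma strict_mono_nat_obtain_block_index:
  fixes p :: "nat \<Rightarrow> nat"
  assumes "strict_mono p"
  obtains k where "\<And>N. p 0 \<le> N \<Longrightarrow> p (k N) \<le> N" "\<And>N. N < p (Suc (k N))"
    "filterlim k at_top sequentially"
proof
  define k where "k N = (LEAST j. N < p (Suc j))" for N
  show upper: "N < p (Suc (k N))" for N
    unfolding k_def by (rule LeastI[of _ N])
      (use strict_mono_imp_increasing[OF assms, of "Suc N"] in simp)
  show "p (k N) \<le> N" if "p 0 \<le> N" for N
    using that not_less_Least[of "k N - 1" "\<lambda>j. N < p (Suc j)"] unfolding k_def[symmetric]
    by (cases "k N") auto
  have "j \<le> k N" if "p j \<le> N" for j N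
    using that upper[of N] strict_mono_less[OF assms, of j "Suc (k N)"] by linarith
  then show "filterlim k at_top sequentially"
    unfolding filterlim_at_top eventually_sequentially by blast
qed

lemma cesaro_mean_tendsto_0_subseq:
  fixes a :: "nat \<Rightarrow> 'a::real_normed_vector"
  assumes bound: "\<And>n. norm (a n) \<le> B" and mono: "strict_mono p"
    and ratio: "(\<lambda>k. real (p (Suc k)) / real (p k)) \<longlonglongrightarrow> 1"
    and subseq: "(\<lambda>k. cesaro_mean a (p k)) \<longlonglongrightarrow> 0"
  shows "cesaro_mean a \<longlonglongrightarrow> 0"
proof -
  obtain k where lower: "\<And>N. p 0 \<le> N \<Longrightarrow> p (k N) \<le> N" and upper: "\<And>N. N < p (Suc (k N))"
    and k_at_top: "filterlim k at_top sequentially"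
    using strict_mono_nat_obtain_block_index[OF mono] by blast
  let ?g = "\<lambda>j. norm (cesaro_mean a (p j)) + B * (real (p (Suc j)) / real (p j) - 1)"
  have "?g \<longlonglongrightarrow> 0 + B * (1 - 1)"
    by (intro tendsto_intros tendsto_norm_zero subseq ratio)
  then have g_tendsto: "(\<lambda>N. ?g (k N)) \<longlonglongrightarrow> 0"
    using filterlim_compose[OF _ k_at_top] by fastforce
  have "B \<ge> 0" using order_trans[OF norm_ge_zero bound] .
  show ?thesis
  proof (rule Lim_null_comparison[OF eventually_sequentiallyI g_tendsto])
    fix N assume "p 1 \<le> N"
    have "p 0 < p 1" using mono by (simp add: strict_mono_less)
    have "0 < k N"
      using le_less_trans[OF \<open>p 1 \<le> N\<close> upper] strict_mono_less[OF mono] by auto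
    with \<open>p 0 < p 1\<close> have "1 \<le> p (k N)"
      using strict_mono_less_eq[OF mono, of 1 "k N"] by linarith
    then have "norm (cesaro_mean a N) \<le> norm (cesaro_mean a (p (k N))) + B * (real N / real (p (k N)) - 1)"
      using \<open>p 0 < p 1\<close> \<open>p 1 \<le> N\<close> by (intro norm_cesaro_mean_le_earlier_mean bound lower) auto
    also have "\<dots> \<le> ?g (k N)"
      using upper[of N] \<open>B \<ge> 0\<close>
      by (intro add_left_mono mult_left_mono diff_right_mono divide_right_mono) auto
    finally show "norm (cesaro_mean a N) \<le> ?g (k N)" .
  qed
qed

lemma strict_mono_power_nat: "M \<ge> 1 \<Longrightarrow> strict_mono (\<lambda>k::nat. k ^ M)"
  by (simp add: strict_mono_def power_strict_mono)

lemma cesaro_mean_tendsto_0_along_powers: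
  fixes a :: "nat \<Rightarrow> 'a::real_normed_vector"
  assumes "\<And>n. norm (a n) \<le> B" "M \<ge> 1" "(\<lambda>k. cesaro_mean a (k ^ M)) \<longlonglongrightarrow> 0"
  shows "cesaro_mean a \<longlonglongrightarrow> 0"
proof (rule cesaro_mean_tendsto_0_subseq[OF assms(1) strict_mono_power_nat[OF assms(2)] _ assms(3)])
  have "(\<lambda>k. (real (Suc k) / real k) ^ M) \<longlonglongrightarrow> 1 ^ M"
    by (intro tendsto_power LIMSEQ_Suc_n_over_n)
  then show "(\<lambda>k. real (Suc k ^ M) / real (k ^ M)) \<longlonglongrightarrow> 1"
    by (simp add: power_divide)
qed

definition averages_to_integral ::
    "'a measure \<Rightarrow> (nat \<Rightarrow> 'a) \<Rightarrow> ('a \<Rightarrow> 'b::{banach,second_countable_topology}) \<Rightarrow> bool" where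
  "averages_to_integral M u f \<longleftrightarrow>
     integrable M f \<and> cesaro_mean (\<lambda>n. f (u n)) \<longlonglongrightarrow> (\<integral>x. f x \<partial>M)"

lemma averages_to_integral_add:
  "averages_to_integral M u f \<Longrightarrow> averages_to_integral M u g \<Longrightarrow> averages_to_integral M u (\<lambda>x. f x + g x)"
  unfolding averages_to_integral_def cesaro_mean_add[abs_def] by (auto intro!: tendsto_add)

lemma averages_to_integral_bounded_linear:
  assumes "bounded_linear T" "averages_to_integral M u f"
  shows "averages_to_integral M u (\<lambda>x. T (f x))"
proof -
  have "cesaro_mean (\<lambda>n. T (f (u n))) = (\<lambda>N. T (cesaro_mean (\<lambda>n. f (u n)) N))"
    using assms(1) by (simp add: fun_eq_iff linear_cesaro_mean bounded_linear.linear)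
  with assms show ?thesis
    by (simp add: averages_to_integral_def integrable_bounded_linear bounded_linear.tendsto
        integral_bounded_linear)
qed

lemma (in finite_measure) norm_integral_diff_le:
  fixes f g :: "'a \<Rightarrow> 'b::{banach,second_countable_topology}"
  assumes "integrable M f" "integrable M g" "\<And>x. norm (f x - g x) \<le> d"
  shows "norm ((\<integral>x. f x \<partial>M) - (\<integral>x. g x \<partial>M)) \<le> d * measure M (space M)"
proof -
  have "norm ((\<integral>x. f x \<partial>M) - (\<integral>x. g x \<partial>M)) = norm (\<integral>x. f x - g x \<partial>M)"
    using assms(1,2) by simp
  also have "\<dots> \<le> (\<integral>x. norm (f x - g x) \<partial>M)"
    by (rule integral_norm_bound)
  also have "\<dots> \<le> (\<integral>x. d \<partial>M)"
    using assms by (intro integral_mono integrable_norm Bochner_Integration.integrable_diff) auto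
  finally show ?thesis by (simp add: mult.commute)
qed

lemma averages_to_integral_uniform_limit:
  fixes f :: "'a \<Rightarrow> 'b::{banach,second_countable_topology}"
  assumes "finite_measure M" and f: "integrable M f"
    and approx: "\<And>e. e > 0 \<Longrightarrow> \<exists>g. averages_to_integral M u g \<and> (\<forall>x. norm (f x - g x) \<le> e)"
  shows "averages_to_integral M u f"
  unfolding averages_to_integral_def
proof (intro conjI f metric_LIMSEQ_I)
  fix e :: real assume "e > 0"
  interpret finite_measure M by fact
  define \<mu> where "\<mu> = measure M (space M)"
  have "\<mu> \<ge> 0" by (simp add: \<mu>_def)
  define d where "d = e / (2 + \<mu>)"
  have "d > 0" and d_eq: "d + d + d * \<mu> = e"
    using \<open>e > 0\<close> \<open>\<mu> \<ge> 0\<close>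
    by (simp_all add: d_def add_divide_distrib[symmetric] divide_eq_eq algebra_simps)
  obtain g where "averages_to_integral M u g" and close: "\<And>x. norm (f x - g x) \<le> d"
    using approx[OF \<open>d > 0\<close>] by blast
  then have g_int: "integrable M g" and g_tendsto: "cesaro_mean (\<lambda>n. g (u n)) \<longlonglongrightarrow> (\<integral>x. g x \<partial>M)"
    by (simp_all add: averages_to_integral_def)
  obtain N\<^sub>0 where g_mean: "\<And>N. N \<ge> N\<^sub>0 \<Longrightarrow> dist (cesaro_mean (\<lambda>n. g (u n)) N) (\<integral>x. g x \<partial>M) < d"
    using metric_LIMSEQ_D[OF g_tendsto \<open>d > 0\<close>] by blast
  have mean_close: "dist (cesaro_mean (\<lambda>n. f (u n)) N) (cesaro_mean (\<lambda>n. g (u n)) N) \<le> d" for N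
    unfolding dist_norm cesaro_mean_diff[symmetric] by (intro norm_cesaro_mean_le close)
  have integral_close: "dist (\<integral>x. f x \<partial>M) (\<integral>x. g x \<partial>M) \<le> d * \<mu>"
    unfolding dist_norm \<mu>_def by (intro norm_integral_diff_le f g_int close)
  have "dist (cesaro_mean (\<lambda>n. f (u n)) N) (\<integral>x. f x \<partial>M) < e" if "N \<ge> N\<^sub>0" for N
    using g_mean[OF that] mean_close[of N] integral_close d_eq by metric
  then show "\<exists>N\<^sub>0. \<forall>N\<ge>N\<^sub>0. dist (cesaro_mean (\<lambda>n. f (u n)) N) (\<integral>x. f x \<partial>M) < e"
    by blast
qed

subsection \<open>Characters on the unit cube\<close>

abbreviation cube_measure :: "'a::euclidean_space measure" where
  "cube_measure \<equiv> lebesgue_on (cbox 0 One)"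

interpretation cube_measure: finite_measure "cube_measure :: 'a::euclidean_space measure"
  by (rule finite_measure_lebesgue_on) simp

lemma measure_cube_measure:
  "S \<in> sets lebesgue \<Longrightarrow> S \<subseteq> cbox 0 One \<Longrightarrow> measure cube_measure S = measure lebesgue S"
  by (rule measure_restrict_space) auto

lemma measure_cube_measure_cbox [simp]: "measure cube_measure (cbox 0 One) = 1"
  by (simp add: measure_cube_measure)

definition character :: "'a::real_inner \<Rightarrow> 'a \<Rightarrow> complex" where
  "character h x = cis (2 * pi * (h \<bullet> x))"

definition integer_vec :: "'a::euclidean_space \<Rightarrow> bool" where
  "integer_vec h \<longleftrightarrow> (\<forall>b\<in>Basis. h \<bullet> b \<in> \<int>)"

lemma integer_vec_add: "integer_vec g \<Longrightarrow> integer_vec h \<Longrightarrow> integer_vec (g + h)"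
  by (auto simp: integer_vec_def inner_add_left)

lemma integer_vec_diff: "integer_vec g \<Longrightarrow> integer_vec h \<Longrightarrow> integer_vec (g - h)"
  by (auto simp: integer_vec_def inner_diff_left)

lemma character_0 [simp]: "character 0 x = 1"
  by (simp add: character_def)

lemma norm_character [simp]: "norm (character h x) = 1"
  by (simp add: character_def)

lemma continuous_on_character [continuous_intros]: "continuous_on S (character h)"
  unfolding character_def by (intro continuous_intros)

lemma character_mult: "character g x * character h x = character (g + h) x"
  by (simp add: character_def cis_mult inner_add_left algebra_simps)

lemma cnj_character: "cnj (character h x) = character (- h) x"
  by (simp add: character_def cis_cnj)

lemma character_eq_prod_Basis: "character h x = (\<Prod>b\<in>Basis. cis (2 * pi * ((h \<bullet> b) * (x \<bullet> b))))"
  unfolding character_def by (subst euclidean_inner)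
    (simp add: cis_conv_exp sum_distrib_left flip: exp_sum)

lemma lipschitz_on_cis: "1-lipschitz_on UNIV cis"
proof (rule bounded_derivative_imp_lipschitz)
  show "(cis has_derivative (\<lambda>h. h *\<^sub>R (\<i> * cis x))) (at x within UNIV)" for x
    by (rule derivative_eq_intros refl | simp)+
  show "onorm (\<lambda>h. h *\<^sub>R (\<i> * cis x)) \<le> 1" for x
    by (rule onorm_le) (simp add: norm_mult)
qed auto

lemma lipschitz_on_character: "(2 * pi * norm h)-lipschitz_on S (character h)"
proof (rule lipschitz_onI)
  fix x y
  have "dist (character h x) (character h y) \<le> 2 * pi * \<bar>h \<bullet> (x - y)\<bar>"
    unfolding character_def
    using lipschitz_onD[OF lipschitz_on_cis, of "2 * pi * (h \<bullet> x)" "2 * pi * (h \<bullet> y)"]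
    by (simp add: dist_real_def inner_diff_right abs_mult flip: right_diff_distrib)
  also have "\<dots> \<le> 2 * pi * (norm h * norm (x - y))"
    by (intro mult_left_mono Cauchy_Schwarz_ineq2) auto
  finally show "dist (character h x) (character h y) \<le> 2 * pi * norm h * dist x y"
    by (simp add: dist_norm mult.assoc)
qed simp

lemma lborel_integral_prod_Basis:
  fixes f :: "'a::euclidean_space \<Rightarrow> real \<Rightarrow> 'b::{real_normed_field,banach,second_countable_topology}"
  assumes integrable: "\<And>b. b \<in> Basis \<Longrightarrow> integrable lborel (f b)"
  shows "(\<integral>x. (\<Prod>b\<in>Basis. f b (x \<bullet> b)) \<partial>lborel) = (\<Prod>b\<in>Basis. \<integral>t. f b t \<partial>lborel)"
proof -
  interpret product_sigma_finite "\<lambda>_::'a. lborel :: real measure"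
    by (simp add: product_sigma_finite_def sigma_finite_lborel)
  have [measurable]: "f b \<in> borel_measurable borel" if "b \<in> Basis" for b
    using integrable[OF that] by (auto dest: borel_measurable_integrable)
  have "(\<integral>x. (\<Prod>b\<in>Basis. f b (x \<bullet> b)) \<partial>lborel)
      = (\<integral>g. (\<Prod>b\<in>Basis. f b ((\<Sum>c\<in>Basis. g c *\<^sub>R c) \<bullet> b)) \<partial>(\<Pi>\<^sub>M b\<in>Basis. lborel))"
    by (subst lborel_eq, subst integral_distr) auto
  also have "\<dots> = (\<integral>g. (\<Prod>b\<in>Basis. f b (g b)) \<partial>(\<Pi>\<^sub>M b\<in>Basis. lborel))"
    by (intro Bochner_Integration.integral_cong prod.cong) auto
  also have "\<dots> = (\<Prod>b\<in>Basis. \<integral>t. f b t \<partial>lborel)"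
    by (rule product_integral_prod) (auto intro: integrable)
  finally show ?thesis .
qed

lemma integral_cis_period_eq_0:
  fixes m :: real
  assumes "m \<in> \<int>" "m \<noteq> 0"
  shows "(\<integral>t. indicator {0..1} t *\<^sub>R cis (2 * pi * (m * t)) \<partial>lborel) = 0"
proof -
  let ?F = "\<lambda>t. cis (2 * pi * (m * t)) / (2 * pi * m * \<i>)"
  have "(\<integral>t. indicator {0..1} t *\<^sub>R cis (2 * pi * (m * t)) \<partial>lborel) = ?F 1 - ?F 0"
  proof (rule integral_FTC_Icc)
    fix t
    show "(?F has_vector_derivative cis (2 * pi * (m * t))) (at t within {0..1})"
      unfolding has_vector_derivative_def
      by (rule derivative_eq_intros refl | simp)+
        (use assms in \<open>auto simp: field_simps scaleR_conv_of_real\<close>)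
  qed (auto intro!: continuous_intros)
  with assms show ?thesis by simp
qed

lemma integral_cube_character:
  fixes h :: "'a::euclidean_space"
  assumes "integer_vec h"
  shows "(\<integral>x. character h x \<partial>cube_measure) = (if h = 0 then 1 else 0)"
proof (cases "h = 0")
  case False
  let ?f = "\<lambda>b t. indicator {0..1} t *\<^sub>R cis (2 * pi * ((h \<bullet> b) * t))"
  have [measurable]: "?f b \<in> borel_measurable borel" for b
    by (intro borel_measurable_scaleR borel_measurable_indicator borel_measurable_continuous_onI
        continuous_intros) simp_all
  have "indicator (cbox 0 One) x = (\<Prod>b\<in>Basis. indicator {0..1} (x \<bullet> b) :: real)" for x :: 'a
    by (auto simp: mem_box split: split_indicator)
  then have "(\<integral>x. character h x \<partial>cube_measure) = (\<integral>x. (\<Prod>b\<in>Basis. ?f b (x \<bullet> b)) \<partial>lebesgue)"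
    by (subst integral_restrict_space)
      (auto simp: character_eq_prod_Basis prod.distrib scaleR_conv_of_real
        intro!: Bochner_Integration.integral_cong)
  also have "\<dots> = (\<integral>x. (\<Prod>b\<in>Basis. ?f b (x \<bullet> b)) \<partial>lborel)"
    by (intro integral_completion) measurable
  also have "\<dots> = (\<Prod>b\<in>Basis. \<integral>t. ?f b t \<partial>lborel)"
    by (intro lborel_integral_prod_Basis borel_integrable_compact) (auto intro!: continuous_intros)
  also obtain b where "b \<in> Basis" "h \<bullet> b \<noteq> 0"
    using False by (metis euclidean_all_zero_iff)
  then have "(\<Prod>b\<in>Basis. \<integral>t. ?f b t \<partial>lborel) = 0"
    using assms integral_cis_period_eq_0[of "h \<bullet> b"] by (force simp: integer_vec_def)
  finally show ?thesis using False by simp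
qed simp

theorem parseval_characters:
  fixes v :: "'i \<Rightarrow> 'a::euclidean_space" and c :: "'i \<Rightarrow> complex"
  assumes "finite I" "inj_on v I" and integer: "\<And>i. i \<in> I \<Longrightarrow> integer_vec (v i)"
  shows "(\<integral>x. (norm (\<Sum>i\<in>I. c i * character (v i) x))\<^sup>2 \<partial>cube_measure) = (\<Sum>i\<in>I. (norm (c i))\<^sup>2)"
proof -
  have expand: "complex_of_real ((norm (\<Sum>i\<in>I. c i * character (v i) x))\<^sup>2)
      = (\<Sum>i\<in>I. \<Sum>j\<in>I. c i * cnj (c j) * character (v i - v j) x)" for x
    by (simp only: complex_norm_square cnj_sum sum_product complex_cnj_mult cnj_character
        diff_conv_add_uminus character_mult[symmetric] mult_ac)
  have integrable: "integrable cube_measure (\<lambda>x. a * character h x)" for a and h :: 'a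
    by (intro continuous_imp_integrable continuous_intros)
  have "complex_of_real (\<integral>x. (norm (\<Sum>i\<in>I. c i * character (v i) x))\<^sup>2 \<partial>cube_measure)
      = (\<integral>x. (\<Sum>i\<in>I. \<Sum>j\<in>I. c i * cnj (c j) * character (v i - v j) x) \<partial>cube_measure)"
    by (simp only: flip: expand integral_complex_of_real)
  also have "\<dots> = (\<Sum>i\<in>I. \<Sum>j\<in>I. \<integral>x. c i * cnj (c j) * character (v i - v j) x \<partial>cube_measure)"
    by (simp add: Bochner_Integration.integral_sum Bochner_Integration.integrable_sum integrable
        del: integral_mult_right_zero)
  also have "\<dots> = (\<Sum>i\<in>I. \<Sum>j\<in>I. if i = j then of_real ((norm (c i))\<^sup>2) else 0)"
  proof (intro sum.cong refl)
    fix i j assume "i \<in> I" "j \<in> I"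
    with assms(2) integer show "(\<integral>x. c i * cnj (c j) * character (v i - v j) x \<partial>cube_measure)
        = (if i = j then of_real ((norm (c i))\<^sup>2) else 0)"
      by (simp add: integral_cube_character integer_vec_diff complex_norm_square inj_on_eq_iff
          del: of_real_power)
  qed
  also have "\<dots> = complex_of_real (\<Sum>i\<in>I. (norm (c i))\<^sup>2)"
    using assms(1) by simp
  finally show ?thesis by (simp only: of_real_eq_iff)
qed

subsection \<open>Weyl's criterion\<close>

inductive trig_poly :: "('a::euclidean_space \<Rightarrow> complex) \<Rightarrow> bool" where
  monomial: "integer_vec h \<Longrightarrow> trig_poly (\<lambda>x. c * character h x)"
| add: "trig_poly f \<Longrightarrow> trig_poly g \<Longrightarrow> trig_poly (\<lambda>x. f x + g x)"

lemma trig_poly_const: "trig_poly (\<lambda>x. c)"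
  using trig_poly.monomial[of 0 c] by (simp add: integer_vec_def)

lemma trig_poly_mult:
  assumes "trig_poly f" "trig_poly g"
  shows "trig_poly (\<lambda>x. f x * g x)"
  using assms(1)
proof induction
  case (monomial h c)
  from assms(2) show ?case
  proof induction
    case (monomial h' c')
    have "(\<lambda>x. c * character h x * (c' * character h' x)) = (\<lambda>x. (c * c') * character (h + h') x)"
      by (simp add: fun_eq_iff mult_ac flip: character_mult)
    then show ?case using monomial \<open>integer_vec h\<close>
      by (metis integer_vec_add trig_poly.monomial)
  next
    case (add f g)
    then show ?case using trig_poly.add[OF add.IH] by (simp add: distrib_left)
  qed
next
  case (add f f')
  then show ?case using trig_poly.add[OF add.IH] by (simp add: distrib_right)
qed

lemma trig_poly_sum:
  "finite I \<Longrightarrow> (\<And>i. i \<in> I \<Longrightarrow> trig_poly (f i)) \<Longrightarrow> trig_poly (\<lambda>x. \<Sum>i\<in>I. f i x)"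
  by (induction I rule: finite_induct) (auto intro: trig_poly_const trig_poly.add)

definition torus_map :: "real ^ 'n \<Rightarrow> complex ^ 'n" where
  "torus_map x = (\<chi> i. cis (2 * pi * x $ i))"

definition frac_vec :: "real ^ 'n \<Rightarrow> real ^ 'n" where
  "frac_vec x = (\<chi> i. frac (x $ i))"

lemma continuous_on_torus_map [continuous_intros]: "continuous_on S torus_map"
  unfolding torus_map_def by (intro continuous_intros)

lemma norm_torus_map_le: "norm (torus_map x :: complex ^ 'n) \<le> real CARD('n)"
proof -
  have "norm (torus_map x) \<le> (\<Sum>i\<in>UNIV. norm (torus_map x $ i))"
    unfolding norm_vec_def by (rule L2_set_le_sum) auto
  then show ?thesis by (simp add: torus_map_def)
qed

lemma cis_2pi_frac: "cis (2 * pi * frac t) = cis (2 * pi * t)"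
proof -
  have "cis (2 * pi * frac t) = cis (2 * pi * t) / cis (2 * pi * of_int \<lfloor>t\<rfloor>)"
    by (simp add: frac_def cis_divide right_diff_distrib del: cis_multiple_2pi)
  then show ?thesis by simp
qed

lemma torus_map_frac_vec: "torus_map (frac_vec x) = torus_map x"
  by (simp add: torus_map_def frac_vec_def cis_2pi_frac)

lemma Ball_Basis_vec_iff: "(\<forall>b\<in>Basis. P (x \<bullet> b)) \<longleftrightarrow> (\<forall>i. P (x $ i))" for x :: "real ^ 'n"
  by (auto simp: Basis_vec_def inner_axis)

lemma mem_cbox_One_iff: "x \<in> cbox 0 (One :: real ^ 'n) \<longleftrightarrow> (\<forall>i. 0 \<le> x $ i \<and> x $ i \<le> 1)"
  using Ball_Basis_vec_iff[of "\<lambda>t. 0 \<le> t \<and> t \<le> 1" x] by (simp add: mem_box)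

lemma mem_box_One_iff: "x \<in> box 0 (One :: real ^ 'n) \<longleftrightarrow> (\<forall>i. 0 < x $ i \<and> x $ i < 1)"
  using Ball_Basis_vec_iff[of "\<lambda>t. 0 < t \<and> t < 1" x] by (simp add: mem_box)

lemma frac_vec_in_cbox: "frac_vec x \<in> cbox 0 One"
  by (auto simp: mem_cbox_One_iff frac_vec_def less_imp_le frac_lt_1 simp del: mem_box_cart)

lemma cis_2pi_eq_imp_eq:
  fixes s t :: real
  assumes "cis (2 * pi * s) = cis (2 * pi * t)" "\<bar>s - t\<bar> < 1"
  shows "s = t"
proof -
  have "cis (2 * pi * s - 2 * pi * t) = 1"
    using assms(1) by (simp flip: cis_divide)
  then have "cos (2 * pi * s - 2 * pi * t) = 1"
    by (metis cis.sel(1) one_complex.sel(1))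
  then obtain m :: int where "2 * pi * s - 2 * pi * t = of_int m * 2 * pi"
    by (auto simp: cos_one_2pi_int)
  then have "2 * pi * (s - t) = 2 * pi * of_int m" by (simp add: algebra_simps)
  then have "s - t = of_int m" by simp
  with assms(2) show ?thesis by (simp add: flip: of_int_abs)
qed

lemma torus_map_mem_image_iff:
  assumes "x \<in> box 0 One" "B \<subseteq> cbox 0 One"
  shows "torus_map x \<in> torus_map ` B \<longleftrightarrow> x \<in> B"
proof
  assume "torus_map x \<in> torus_map ` B"
  then obtain y where y: "y \<in> B" "torus_map x = torus_map y" by auto
  have "x $ i = y $ i" for i
  proof (rule cis_2pi_eq_imp_eq)
    show "cis (2 * pi * x $ i) = cis (2 * pi * y $ i)"
      using y(2) by (simp add: torus_map_def vec_eq_iff)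
    have "0 < x $ i" "x $ i < 1" "0 \<le> y $ i" "y $ i \<le> 1"
      using assms y(1) mem_cbox_One_iff[of y] mem_box_One_iff[of x] by auto
    then show "\<bar>x $ i - y $ i\<bar> < 1" by linarith
  qed
  with y(1) show "x \<in> B" by (metis vec_eq_iff)
qed auto

lemma trig_poly_torus_map_component:
  fixes b :: "complex ^ 'n"
  assumes "b \<in> Basis"
  shows "trig_poly (\<lambda>x. complex_of_real (torus_map x \<bullet> b))"
proof -
  obtain i u where b: "u \<in> Basis" "b = axis i u"
    using assms by (auto simp: Basis_vec_def)
  have integer: "integer_vec (axis i 1 :: real ^ 'n)" "integer_vec (- axis i 1 :: real ^ 'n)"
    by (auto simp: integer_vec_def Basis_vec_def inner_axis_axis)
  define c c' where "c = cnj u / 2" and "c' = u / 2"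
  have "complex_of_real (torus_map x \<bullet> b)
      = c * character (axis i 1) x + c' * character (- axis i 1) x" for x
    using b by (auto simp: c_def c'_def character_def inner_axis inner_axis' torus_map_def
        Basis_complex_def inner_complex_def complex_eq_iff)
  then show ?thesis by (simp only:) (intro trig_poly.intros integer)
qed

lemma trig_poly_of_real_polynomial:
  assumes "real_polynomial_function (g :: complex ^ 'n \<Rightarrow> real)"
  shows "trig_poly (\<lambda>x. complex_of_real (g (torus_map x)))"
  using assms
proof induction
  case (linear f)
  have componentwise: "f z = (\<Sum>b\<in>Basis. (z \<bullet> b) * f b)" for z
    using linear_sum[OF bounded_linear.linear[OF linear], of "\<lambda>b. (z \<bullet> b) *\<^sub>R b" Basis]
    by (simp add: euclidean_representation linear_scale[OF bounded_linear.linear[OF linear]])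
  have "(\<lambda>x. complex_of_real (f (torus_map x)))
      = (\<lambda>x. \<Sum>b\<in>Basis. complex_of_real (torus_map x \<bullet> b) * complex_of_real (f b))"
    by (rule ext, subst componentwise) simp
  then show ?case
    by (simp only:) (intro trig_poly_sum trig_poly_mult trig_poly_const
        trig_poly_torus_map_component finite_Basis)
next
  case (const c)
  then show ?case by (rule trig_poly_const)
next
  case (add f g)
  then show ?case using trig_poly.add[OF add.IH] by simp
next
  case (mult f g)
  then show ?case using trig_poly_mult[OF mult.IH] by simp
qed

definition weyl_means_vanish :: "(nat \<Rightarrow> 'a::euclidean_space) \<Rightarrow> bool" where
  "weyl_means_vanish u \<longleftrightarrow>
     (\<forall>h. integer_vec h \<and> h \<noteq> 0 \<longrightarrow> cesaro_mean (\<lambda>n. character h (u n)) \<longlonglongrightarrow> 0)"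

lemma averages_to_integral_character:
  assumes "weyl_means_vanish u" "integer_vec h"
  shows "averages_to_integral cube_measure u (character h)"
  unfolding averages_to_integral_def integral_cube_character[OF assms(2)]
proof
  show "integrable cube_measure (character h)"
    by (intro continuous_imp_integrable continuous_intros)
  show "cesaro_mean (\<lambda>n. character h (u n)) \<longlonglongrightarrow> (if h = 0 then 1 else 0)"
  proof (cases "h = 0")
    case True
    have "\<forall>\<^sub>F N in sequentially. cesaro_mean (\<lambda>n. 1 :: complex) N = 1"
      using eventually_ge_at_top[of 1] by eventually_elim (rule cesaro_mean_const)
    with True show ?thesis by (simp add: tendsto_eventually)
  qed (use assms in \<open>simp add: weyl_means_vanish_def\<close>)
qed

lemma averages_to_integral_trig_poly:
  assumes "weyl_means_vanish u" "trig_poly f"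
  shows "averages_to_integral cube_measure u f"
  using assms(2)
proof induction
  case (monomial h c)
  then show ?case
    using averages_to_integral_character[OF assms(1)]
    by (intro averages_to_integral_bounded_linear[OF bounded_linear_mult_right])
next
  case (add f g)
  then show ?case by (intro averages_to_integral_add)
qed

lemma averages_to_integral_torus:
  fixes F :: "complex ^ 'n \<Rightarrow> real"
  assumes u: "weyl_means_vanish u" and F: "continuous_on UNIV F"
  shows "averages_to_integral cube_measure u (\<lambda>x. F (torus_map x))"
proof (rule averages_to_integral_uniform_limit)
  show "finite_measure (cube_measure :: (real ^ 'n) measure)"
    by (rule cube_measure.finite_measure_axioms)
  show "integrable cube_measure (\<lambda>x. F (torus_map x))"
    by (intro continuous_imp_integrable continuous_on_compose2[OF F] continuous_intros) auto
  fix e :: real assume "e > 0"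
  have "continuous_on (cball 0 (real CARD('n))) F" using F by (rule continuous_on_subset) auto
  then obtain g where g: "real_polynomial_function g"
    and g_close: "\<And>z. z \<in> cball 0 (real CARD('n)) \<Longrightarrow> \<bar>F z - g z\<bar> < e"
    using Stone_Weierstrass_real_polynomial_function[OF compact_cball _ \<open>e > 0\<close>] by metis
  have "averages_to_integral cube_measure u (\<lambda>x. complex_of_real (g (torus_map x)))"
    using u trig_poly_of_real_polynomial[OF g] by (rule averages_to_integral_trig_poly)
  then have "averages_to_integral cube_measure u (\<lambda>x. g (torus_map x))"
    using averages_to_integral_bounded_linear[OF bounded_linear_Re] by fastforce
  moreover have "norm (F (torus_map x) - g (torus_map x)) \<le> e" for x
    using g_close[of "torus_map x"] norm_torus_map_le[of x] by (simp add: less_imp_le)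
  ultimately show "\<exists>g. averages_to_integral cube_measure u g \<and> (\<forall>x. norm (F (torus_map x) - g x) \<le> e)"
    by blast
qed

definition bump :: "'a::metric_space set \<Rightarrow> nat \<Rightarrow> 'a \<Rightarrow> real" where
  "bump K k z = max 0 (1 - real k * infdist z K)"

lemma continuous_on_bump: "continuous_on S (bump K k)"
  unfolding bump_def by (intro continuous_intros)

lemma indicator_le_bump: "indicator K z \<le> bump K k z"
  by (simp add: bump_def indicator_def)

lemma bump_tendsto_indicator:
  assumes "closed K" "K \<noteq> {}"
  shows "(\<lambda>k. bump K k z) \<longlonglongrightarrow> indicator K z"
proof (cases "z \<in> K")
  case True
  then show ?thesis by (simp add: bump_def)
next
  case False
  with assms have "infdist z K > 0" by (simp add: infdist_pos_not_in_closed)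
  then obtain k0 where "1 < real k0 * infdist z K" using reals_Archimedean3 by blast
  then have "bump K k z = 0" if "k \<ge> k0" for k
    using that \<open>infdist z K > 0\<close> mult_right_mono[of "real k0" "real k" "infdist z K"]
    unfolding bump_def by linarith
  then have "\<forall>\<^sub>F k in sequentially. bump K k z = 0"
    unfolding eventually_sequentially by blast
  with False show ?thesis by (simp add: tendsto_eventually)
qed

lemma AE_cube_measure_interior: "AE x in cube_measure. x \<in> box 0 (One :: 'a::euclidean_space)"
proof -
  have "AE x in lebesgue. x \<notin> cbox 0 One - box 0 (One :: 'a)"
    using negligible_frontier_interval by (intro AE_not_in) (simp add: negligible_iff_null_sets)
  then show ?thesis by (subst AE_restrict_space_iff) auto
qed

lemma integral_bump_torus_tendsto:
  fixes B :: "(real ^ 'n) set"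
  assumes B: "compact B" "B \<subseteq> cbox 0 One" "B \<noteq> {}"
  shows "(\<lambda>k. \<integral>x. bump (torus_map ` B) k (torus_map x) \<partial>cube_measure) \<longlonglongrightarrow> measure lebesgue B"
proof -
  have image_closed: "closed (torus_map ` B)" "torus_map ` B \<noteq> {}"
    using B by (auto intro!: compact_imp_closed compact_continuous_image continuous_intros)
  have "B \<in> sets lebesgue"
    using lmeasurable_compact[OF B(1)] by (rule fmeasurableD)
  then have B_sets: "B \<in> sets cube_measure"
    using B(2) by (simp add: sets_restrict_space_iff)
  have "(\<lambda>k. \<integral>x. bump (torus_map ` B) k (torus_map x) \<partial>cube_measure)
      \<longlonglongrightarrow> (\<integral>x. indicator B x \<partial>cube_measure)"
  proof (rule integral_dominated_convergence[where w = "\<lambda>_. 1"])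
    show "indicator B \<in> borel_measurable cube_measure"
      using B_sets by simp
    have "integrable cube_measure (\<lambda>x. bump (torus_map ` B) k (torus_map x))" for k
      by (intro continuous_imp_integrable
          continuous_on_compose2[OF continuous_on_bump[of UNIV] continuous_on_torus_map]) simp
    then show "(\<lambda>x. bump (torus_map ` B) k (torus_map x)) \<in> borel_measurable cube_measure" for k
      by (rule borel_measurable_integrable)
    show "AE x in cube_measure. (\<lambda>k. bump (torus_map ` B) k (torus_map x)) \<longlonglongrightarrow> indicator B x"
      using AE_cube_measure_interior
    proof eventually_elim
      case (elim x)
      with B(2) have "indicator B x = (indicator (torus_map ` B) (torus_map x) :: real)"
        by (simp add: indicator_def torus_map_mem_image_iff)
      then show ?case using bump_tendsto_indicator[OF image_closed] by simp
    qed
    show "AE x in cube_measure. norm (bump (torus_map ` B) k (torus_map x)) \<le> 1" for k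
      by (intro AE_I2) (simp add: bump_def infdist_nonneg)
  qed simp
  moreover have "(\<integral>x. indicator B x \<partial>cube_measure) = measure lebesgue B"
    using \<open>B \<in> sets lebesgue\<close> B(2) by (simp add: Int_absorb2 measure_cube_measure)
  ultimately show ?thesis by simp
qed

lemma eventually_cesaro_mean_indicator_less:
  fixes u :: "nat \<Rightarrow> real ^ 'n"
  assumes u: "weyl_means_vanish u"
    and B: "compact B" "B \<subseteq> cbox 0 One" and measure_less: "measure lebesgue B < c"
  shows "\<forall>\<^sub>F N in sequentially. cesaro_mean (\<lambda>n. indicator B (frac_vec (u n))) N < c"
proof (cases "B = {}")
  case True
  with measure_less show ?thesis by (simp add: cesaro_mean_def)
next
  case False
  let ?bump = "bump (torus_map ` B)"
  obtain k where k: "(\<integral>x. ?bump k (torus_map x) \<partial>cube_measure) < c"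
    using order_tendstoD(2)[OF integral_bump_torus_tendsto[OF B False] measure_less]
    by (auto simp: eventually_sequentially)
  have "(\<lambda>N. cesaro_mean (\<lambda>n. ?bump k (torus_map (u n))) N) \<longlonglongrightarrow> (\<integral>x. ?bump k (torus_map x) \<partial>cube_measure)"
    using averages_to_integral_torus[OF u continuous_on_bump] by (simp add: averages_to_integral_def)
  then have "\<forall>\<^sub>F N in sequentially. cesaro_mean (\<lambda>n. ?bump k (torus_map (u n))) N < c"
    using k by (rule order_tendstoD(2))
  then show ?thesis
  proof eventually_elim
    case (elim N)
    have "indicator B (frac_vec (u n)) \<le> ?bump k (torus_map (u n))" for n
    proof -
      have "indicator B (frac_vec (u n)) \<le> (indicator (torus_map ` B) (torus_map (u n)) :: real)"
        using torus_map_frac_vec[of "u n"] by (auto simp: indicator_def intro: rev_image_eqI)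
      also have "\<dots> \<le> ?bump k (torus_map (u n))" by (rule indicator_le_bump)
      finally show ?thesis .
    qed
    with elim show ?case by (meson cesaro_mean_mono le_less_trans)
  qed
qed

lemma eventually_less_cesaro_mean_indicator:
  fixes u :: "nat \<Rightarrow> real ^ 'n"
  assumes u: "weyl_means_vanish u"
    and B: "open B" "B \<subseteq> cbox 0 One" and less_measure: "c < measure lebesgue B"
  shows "\<forall>\<^sub>F N in sequentially. c < cesaro_mean (\<lambda>n. indicator B (frac_vec (u n))) N"
proof -
  define C where "C = cbox 0 One - B"
  have "bounded B" using B(2) bounded_cbox bounded_subset by blast
  then have "measure lebesgue C = 1 - measure lebesgue B"
    unfolding C_def using B
    by (subst measurable_measure_Diff) (auto simp: lmeasurable_open fmeasurableD)
  then have "\<forall>\<^sub>F N in sequentially. cesaro_mean (\<lambda>n. indicator C (frac_vec (u n))) N < 1 - c"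
    using less_measure B(1)
    by (intro eventually_cesaro_mean_indicator_less u) (auto simp: C_def compact_diff)
  then show ?thesis
    using eventually_ge_at_top[of 1]
  proof eventually_elim
    case (elim N)
    have "indicator B (frac_vec (u n)) + indicator C (frac_vec (u n)) = (1 :: real)" for n
      using frac_vec_in_cbox[of "u n"] by (simp add: C_def indicator_def)
    with elim(2) have "(1 :: real)
        = cesaro_mean (\<lambda>n. indicator B (frac_vec (u n)) + indicator C (frac_vec (u n))) N"
      by (simp only: cesaro_mean_const)
    also have "\<dots> = cesaro_mean (\<lambda>n. indicator B (frac_vec (u n))) N
        + cesaro_mean (\<lambda>n. indicator C (frac_vec (u n))) N"
      by (rule cesaro_mean_add)
    finally show ?case using elim(1) by linarith
  qed
qed

lemma cesaro_mean_indicator_tendsto_Jordan: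
  fixes u :: "nat \<Rightarrow> real ^ 'n"
  assumes u: "weyl_means_vanish u"
    and B: "B \<subseteq> cbox 0 One" "negligible (frontier B)"
  shows "cesaro_mean (\<lambda>n. indicator B (frac_vec (u n))) \<longlonglongrightarrow> measure lebesgue B"
proof -
  have "bounded B" using B(1) bounded_cbox bounded_subset by blast
  show ?thesis
  proof (rule order_tendstoI)
    fix y assume "measure lebesgue B < y"
    then have "measure lebesgue (closure B) < y"
      unfolding measure_closure[OF \<open>bounded B\<close> B(2)] .
    then have "\<forall>\<^sub>F N in sequentially. cesaro_mean (\<lambda>n. indicator (closure B) (frac_vec (u n))) N < y"
      using \<open>bounded B\<close>
      by (intro eventually_cesaro_mean_indicator_less u closure_minimal[OF B(1) closed_cbox]) simp_all
    then show "\<forall>\<^sub>F N in sequentially. cesaro_mean (\<lambda>n. indicator B (frac_vec (u n))) N < y"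
      by eventually_elim (rule le_less_trans[OF cesaro_mean_mono],
          auto simp: indicator_def closure_subset[THEN subsetD])
  next
    fix y assume "y < measure lebesgue B"
    then have "y < measure lebesgue (interior B)"
      unfolding measure_interior[OF \<open>bounded B\<close> B(2)] .
    then have "\<forall>\<^sub>F N in sequentially. y < cesaro_mean (\<lambda>n. indicator (interior B) (frac_vec (u n))) N"
      by (intro eventually_less_cesaro_mean_indicator u order_trans[OF interior_subset B(1)]) simp_all
    then show "\<forall>\<^sub>F N in sequentially. y < cesaro_mean (\<lambda>n. indicator B (frac_vec (u n))) N"
      by eventually_elim (rule less_le_trans[OF _ cesaro_mean_mono],
          auto simp: indicator_def interior_subset[THEN subsetD])
  qed
qed

definition half_open_box :: "real ^ 'n \<Rightarrow> real ^ 'n \<Rightarrow> (real ^ 'n) set" where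
  "half_open_box a b = {x. \<forall>i. x $ i \<in> {a $ i..<b $ i}}"

lemma box_subset_half_open_box: "box a b \<subseteq> half_open_box a b"
  by (auto simp: half_open_box_def mem_box_cart less_imp_le)

lemma half_open_box_subset_cbox: "half_open_box a b \<subseteq> cbox a b"
  by (auto simp: half_open_box_def mem_box_cart less_imp_le)

lemma negligible_frontier_half_open_box: "negligible (frontier (half_open_box a b))"
proof (rule negligible_subset[OF negligible_frontier_interval])
  have "closure (half_open_box a b) \<subseteq> cbox a b"
    using half_open_box_subset_cbox closed_cbox by (rule closure_minimal)
  moreover have "box a b \<subseteq> interior (half_open_box a b)"
    using box_subset_half_open_box open_box by (rule interior_maximal)
  ultimately show "frontier (half_open_box a b) \<subseteq> cbox a b - box a b"
    unfolding frontier_def by blast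
qed

lemma measure_half_open_box:
  fixes a b :: "real ^ 'n"
  assumes "\<And>i. a $ i \<le> b $ i"
  shows "measure lebesgue (half_open_box a b) = (\<Prod>i\<in>UNIV. b $ i - a $ i)"
proof -
  have "(cbox a b - half_open_box a b) \<union> (half_open_box a b - cbox a b) \<subseteq> cbox a b - box a b"
    using box_subset_half_open_box half_open_box_subset_cbox by blast
  then have "measure lebesgue (half_open_box a b) = measure lebesgue (cbox a b)"
    by (rule measure_negligible_symdiff[OF lmeasurable_cbox
          negligible_subset[OF negligible_frontier_interval]])
  also have "\<dots> = (\<Prod>i\<in>UNIV. b $ i - a $ i)"
    using assms by (simp add: content_cbox_cart interval_ne_empty_cart)
  finally show ?thesis .
qed

theorem weyl_criterion:
  assumes "weyl_means_vanish (u :: nat \<Rightarrow> real ^ 'n)"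
  shows "uniformly_distributed_mod1 u"
  unfolding uniformly_distributed_mod1_def
proof (intro allI impI)
  fix a b :: "real ^ 'n"
  assume ab: "\<forall>i. 0 \<le> a $ i \<and> a $ i < b $ i \<and> b $ i \<le> 1"
  have "half_open_box a b \<subseteq> cbox 0 One"
  proof
    fix x assume "x \<in> half_open_box a b"
    with ab show "x \<in> cbox 0 One"
      unfolding half_open_box_def mem_Collect_eq mem_cbox_One_iff atLeastLessThan_iff
      by (meson less_imp_le order_trans)
  qed
  then have "cesaro_mean (\<lambda>n. indicator (half_open_box a b) (frac_vec (u n)))
      \<longlonglongrightarrow> measure lebesgue (half_open_box a b)"
    using negligible_frontier_half_open_box by (rule cesaro_mean_indicator_tendsto_Jordan[OF assms])
  moreover have "measure lebesgue (half_open_box a b) = (\<Prod>i\<in>UNIV. b $ i - a $ i)"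
    using ab by (intro measure_half_open_box) (simp add: less_imp_le)
  moreover have "cesaro_mean (\<lambda>n. indicator (half_open_box a b) (frac_vec (u n)))
      = (\<lambda>N. real (card {n \<in> {1..N}. \<forall>i. frac (u n $ i) \<in> {a $ i..<b $ i}}) / real N)"
    by (simp add: fun_eq_iff cesaro_mean_def half_open_box_def frac_vec_def indicator_def sum.If_cases
        Int_def divide_inverse_commute)
  ultimately show "(\<lambda>N. real (card {n \<in> {1..N}. \<forall>i. frac (u n $ i) \<in> {a $ i..<b $ i}}) / real N)
      \<longlonglongrightarrow> (\<Prod>i\<in>UNIV. b $ i - a $ i)"
    by simp
qed

subsection \<open>Hausdorff null sets\<close>

lemma hausdorff_premeasure_le_cover:
  assumes "E \<subseteq> (\<Union>i. U i)" "\<And>i. bounded (U i)" "\<And>i. diameter (U i) \<le> \<delta>"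
  shows "hausdorff_premeasure s \<delta> E \<le> (\<Sum>i. diam_power s (U i))"
  unfolding hausdorff_premeasure_def using assms by (intro INF_lower) auto

lemma diam_power_le:
  assumes "bounded U" "diameter U \<le> r" "0 < r" "0 \<le> s"
  shows "diam_power s U \<le> ennreal (r powr s)"
  using assms by (auto simp: diam_power_def intro!: ennreal_leI powr_mono2 diameter_ge_0)

lemma hausdorff_premeasure_le_finite_cover:
  assumes "finite I" "E \<subseteq> (\<Union>i\<in>I. U i)" "0 < r" "r \<le> \<delta>" "0 \<le> s"
    and U: "\<And>i. i \<in> I \<Longrightarrow> bounded (U i)" "\<And>i. i \<in> I \<Longrightarrow> diameter (U i) \<le> r"
  shows "hausdorff_premeasure s \<delta> E \<le> ennreal (real (card I) * r powr s)"
proof -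
  obtain f where f: "bij_betw f {..<card I} I"
    using assms(1) by (metis ex_bij_betw_nat_finite lessThan_atLeast0)
  have f_mem: "f j \<in> I" if "j < card I" for j
    using bij_betwE[OF f] that by simp
  define V where "V j = (if j < card I then U (f j) else {})" for j
  have "(\<Union>i\<in>I. U i) = (\<Union>j<card I. U (f j))"
    using bij_betw_imp_surj_on[OF f] by (metis image_image)
  then have "E \<subseteq> (\<Union>j. V j)"
    using assms(2) by (fastforce simp: V_def)
  then have "hausdorff_premeasure s \<delta> E \<le> (\<Sum>j. diam_power s (V j))"
    using assms(3,4) U(1) f_mem order_trans[OF U(2)[OF f_mem] assms(4)]
    by (intro hausdorff_premeasure_le_cover) (auto simp: V_def)
  also have "\<dots> = (\<Sum>j<card I. diam_power s (V j))"
    by (rule suminf_finite) (auto simp: V_def diam_power_def)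
  also have "\<dots> \<le> (\<Sum>j<card I. ennreal (r powr s))"
    using U f_mem assms(3,5) by (intro sum_mono) (simp add: V_def diam_power_le)
  also have "\<dots> = ennreal (real (card I) * r powr s)"
    by (simp add: ennreal_mult ennreal_of_nat_eq_real_of_nat)
  finally show ?thesis .
qed

lemma hausdorff_premeasure_mono:
  assumes "E \<subseteq> F"
  shows "hausdorff_premeasure s \<delta> E \<le> hausdorff_premeasure s \<delta> F"
  unfolding hausdorff_premeasure_def using assms by (intro INF_superset_mono) auto

lemma hausdorff_premeasure_approx:
  assumes "hausdorff_premeasure s \<delta> E < \<infinity>" "0 < e"
  obtains U where "E \<subseteq> (\<Union>i. U i)" "\<And>i. bounded (U i)" "\<And>i. diameter (U i) \<le> \<delta>"
    "(\<Sum>i. diam_power s (U i)) < hausdorff_premeasure s \<delta> E + ennreal e"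
  using INF_approx_ennreal[OF assms(2) hausdorff_premeasure_def[of s \<delta> E]] assms(1)
  by (auto simp: less_top)

lemma hausdorff_premeasure_countable_subadditive:
  "hausdorff_premeasure s \<delta> (\<Union>i::nat. E i) \<le> (\<Sum>i. hausdorff_premeasure s \<delta> (E i))"
proof (rule ennreal_le_epsilon)
  fix e :: real assume fin: "(\<Sum>i. hausdorff_premeasure s \<delta> (E i)) < top" and "0 < e"
  have "\<exists>U. E i \<subseteq> (\<Union>j. U j) \<and> (\<forall>j. bounded (U j) \<and> diameter (U j) \<le> \<delta>) \<and>
      (\<Sum>j. diam_power s (U j)) \<le> hausdorff_premeasure s \<delta> (E i) + ennreal (e * (1/2) ^ Suc i)" for i
  proof -
    have "hausdorff_premeasure s \<delta> (E i) < \<infinity>" "0 < e * (1/2) ^ Suc i"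
      using fin ennreal_suminf_lessD \<open>0 < e\<close> by auto
    then show ?thesis by (rule hausdorff_premeasure_approx) (blast intro: less_imp_le)
  qed
  then obtain U where cover: "\<And>i. E i \<subseteq> (\<Union>j. U i j)"
    and U: "\<And>i j. bounded (U i j)" "\<And>i j. diameter (U i j) \<le> \<delta>"
    and sum_le: "\<And>i. (\<Sum>j. diam_power s (U i j))
      \<le> hausdorff_premeasure s \<delta> (E i) + ennreal (e * (1/2) ^ Suc i)"
    by metis
  have "(\<Union>i. E i) \<subseteq> (\<Union>k. case_prod U (prod_decode k))"
  proof clarify
    fix x i assume "x \<in> E i"
    with cover obtain j where "x \<in> U i j" by blast
    then show "x \<in> (\<Union>k. case_prod U (prod_decode k))"
      by (intro UN_I[of "prod_encode (i, j)"]) auto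
  qed
  then have "hausdorff_premeasure s \<delta> (\<Union>i. E i) \<le> (\<Sum>k. diam_power s (case_prod U (prod_decode k)))"
    using U by (intro hausdorff_premeasure_le_cover) (auto split: prod.split)
  also have "\<dots> = (\<Sum>i. \<Sum>j. diam_power s (U i j))"
    using suminf_ennreal_2dimen[of "\<lambda>i. \<Sum>j. diam_power s (U i j)" "\<lambda>p. diam_power s (case_prod U p)"]
    by (simp add: o_def)
  also have "\<dots> \<le> (\<Sum>i. hausdorff_premeasure s \<delta> (E i) + ennreal (e * (1/2) ^ Suc i))"
    by (intro suminf_le sum_le) auto
  also have "\<dots> = (\<Sum>i. hausdorff_premeasure s \<delta> (E i)) + (\<Sum>i. ennreal (e * (1/2) ^ Suc i))"
    by (intro suminf_add[symmetric]) auto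
  also have "(\<Sum>i. ennreal (e * (1/2) ^ Suc i)) = ennreal e"
    using \<open>0 < e\<close> sums_mult[OF power_half_series, of e] by (intro suminf_ennreal_eq) auto
  finally show "hausdorff_premeasure s \<delta> (\<Union>i. E i) \<le> (\<Sum>i. hausdorff_premeasure s \<delta> (E i)) + ennreal e" .
qed

lemma hausdorff_measure_eq_0_iff:
  "hausdorff_measure s E = 0 \<longleftrightarrow> (\<forall>\<delta>>0. hausdorff_premeasure s \<delta> E = 0)"
  unfolding hausdorff_measure_def bot_ennreal[symmetric]
  by (subst SUP_eq_iff) auto

lemma hausdorff_measure_eq_0_subset:
  "hausdorff_measure s F = 0 \<Longrightarrow> E \<subseteq> F \<Longrightarrow> hausdorff_measure s E = 0"
  unfolding hausdorff_measure_eq_0_iff by (metis hausdorff_premeasure_mono le_zero_eq)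

lemma hausdorff_measure_Union_sequence_eq_0:
  fixes E :: "nat \<Rightarrow> 'a::metric_space set"
  assumes "\<And>i. hausdorff_measure s (E i) = 0"
  shows "hausdorff_measure s (\<Union>i. E i) = 0"
  unfolding hausdorff_measure_eq_0_iff
proof (intro allI impI)
  fix \<delta> :: real assume "\<delta> > 0"
  then have "hausdorff_premeasure s \<delta> (E i) = 0" for i
    using assms by (simp add: hausdorff_measure_eq_0_iff)
  then show "hausdorff_premeasure s \<delta> (\<Union>i. E i) = 0"
    using hausdorff_premeasure_countable_subadditive[of s \<delta> E] by simp
qed

lemma hausdorff_measure_empty [simp]: "hausdorff_measure s ({} :: 'a::metric_space set) = 0"
  unfolding hausdorff_measure_eq_0_iff
  using hausdorff_premeasure_le_cover[of "{} :: 'a set" "\<lambda>_. {}"] by (auto simp: diam_power_def)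

lemma hausdorff_measure_countable_Union_eq_0:
  assumes "countable I" "\<And>i. i \<in> I \<Longrightarrow> hausdorff_measure s (E i) = 0"
  shows "hausdorff_measure s (\<Union>i\<in>I. E i) = 0"
proof (cases "I = {}")
  case False
  then have "(\<Union>i\<in>I. E i) = (\<Union>n. E (from_nat_into I n))"
    using range_from_nat_into[OF False assms(1)] by (metis image_image)
  with False assms(2) show ?thesis
    by (simp add: hausdorff_measure_Union_sequence_eq_0 from_nat_into)
qed simp

theorem hausdorff_measure_limsup_eq_0:
  assumes "summable w" "\<And>k. w k \<ge> 0"
    and le_w: "\<And>\<delta>. \<delta> > 0 \<Longrightarrow> \<forall>\<^sub>F k in sequentially. hausdorff_premeasure s \<delta> (B k) \<le> ennreal (w k)"
  shows "hausdorff_measure s {x. \<exists>\<^sub>F k in sequentially. x \<in> B k} = 0"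
proof -
  have "hausdorff_premeasure s \<delta> {x. \<exists>\<^sub>F k in sequentially. x \<in> B k} \<le> 0" (is "?H \<le> 0") if "\<delta> > 0" for \<delta>
  proof (rule ennreal_le_epsilon)
    fix e :: real assume "0 < e"
    obtain K\<^sub>1 where tail_less: "\<And>n. n \<ge> K\<^sub>1 \<Longrightarrow> norm (\<Sum>i. w (i + n)) < e"
      using suminf_exist_split[OF \<open>0 < e\<close> assms(1)] by blast
    obtain K\<^sub>2 where premeasure_le: "\<And>k. k \<ge> K\<^sub>2 \<Longrightarrow> hausdorff_premeasure s \<delta> (B k) \<le> ennreal (w k)"
      using le_w[OF \<open>\<delta> > 0\<close>] by (auto simp: eventually_sequentially)
    define K where "K = max K\<^sub>1 K\<^sub>2"
    have "{x. \<exists>\<^sub>F k in sequentially. x \<in> B k} \<subseteq> (\<Union>i. B (i + K))"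
    proof clarify
      fix x assume "\<exists>\<^sub>F k in sequentially. x \<in> B k"
      then obtain k where "k \<ge> K" "x \<in> B k" by (auto simp: frequently_sequentially)
      then show "x \<in> (\<Union>i. B (i + K))" by (intro UN_I[of "k - K"]) auto
    qed
    then have "?H \<le> (\<Sum>i. hausdorff_premeasure s \<delta> (B (i + K)))"
      by (rule order_trans[OF hausdorff_premeasure_mono hausdorff_premeasure_countable_subadditive])
    also have "\<dots> \<le> (\<Sum>i. ennreal (w (i + K)))"
      by (intro suminf_le premeasure_le) (auto simp: K_def)
    also have "\<dots> = ennreal (\<Sum>i. w (i + K))"
      using assms(1,2) by (intro suminf_ennreal2) (auto simp: summable_iff_shift)
    also have "\<dots> \<le> ennreal e"
      using tail_less[of K] by (intro ennreal_leI) (auto simp: K_def)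
    finally show "?H \<le> 0 + ennreal e" by simp
  qed
  then show ?thesis by (auto simp: hausdorff_measure_eq_0_iff)
qed

lemma hausdorff_dim_leI:
  assumes "0 \<le> t" "\<And>s. t < s \<Longrightarrow> hausdorff_measure s E = 0"
  shows "hausdorff_dim E \<le> ereal t"
proof (rule ereal_le_epsilon2)
  show "hausdorff_dim E \<le> ereal t + ereal e" if "e > 0" for e
    unfolding hausdorff_dim_def using assms that by (auto intro!: INF_lower)
qed

subsection \<open>Large values of Lipschitz functions\<close>

definition grid_cell :: "nat \<Rightarrow> ('a \<Rightarrow> nat) \<Rightarrow> 'a::euclidean_space set" where
  "grid_cell q k = cbox (\<Sum>b\<in>Basis. (real (k b) / real q) *\<^sub>R b)
     (\<Sum>b\<in>Basis. (real (Suc (k b)) / real q) *\<^sub>R b)"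

lemma mem_grid_cell:
  "x \<in> grid_cell q k \<longleftrightarrow> (\<forall>b\<in>Basis. real (k b) / real q \<le> x \<bullet> b \<and> x \<bullet> b \<le> real (Suc (k b)) / real q)"
  by (simp add: grid_cell_def mem_box)

lemma mem_interior_grid_cell:
  "x \<in> interior (grid_cell q k) \<longleftrightarrow>
     (\<forall>b\<in>Basis. real (k b) / real q < x \<bullet> b \<and> x \<bullet> b < real (Suc (k b)) / real q)"
  by (simp add: grid_cell_def mem_box)

lemma measure_interior_grid_cell:
  "measure lebesgue (interior (grid_cell q k :: 'a::euclidean_space set)) = (1 / real q) ^ DIM('a)"
proof -
  have "measure lebesgue (interior (grid_cell q k :: 'a set))
      = (\<Prod>b\<in>(Basis :: 'a set). real (Suc (k b)) / real q - real (k b) / real q)"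
    by (simp add: grid_cell_def measure_lborel_box_eq inner_diff_left divide_right_mono)
  also have "\<dots> = (\<Prod>b\<in>(Basis :: 'a set). 1 / real q)"
    by (intro prod.cong refl) (simp flip: diff_divide_distrib)
  finally show ?thesis by simp
qed

lemma disjoint_family_on_interior_grid_cell:
  assumes "q \<ge> 1"
  shows "disjoint_family_on (\<lambda>k. interior (grid_cell q k)) (Basis \<rightarrow>\<^sub>E UNIV)"
  unfolding disjoint_family_on_def
proof (intro ballI impI equals0I)
  fix k l :: "'a \<Rightarrow> nat" and x :: 'a
  assume kl: "k \<in> Basis \<rightarrow>\<^sub>E UNIV" "l \<in> Basis \<rightarrow>\<^sub>E UNIV" "k \<noteq> l"
    and x: "x \<in> interior (grid_cell q k) \<inter> interior (grid_cell q l)"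
  have index: "int (m b) = \<lfloor>real q * (x \<bullet> b)\<rfloor>" if "x \<in> interior (grid_cell q m)" "b \<in> Basis" for m b
  proof -
    have "real (m b) / real q < x \<bullet> b" "x \<bullet> b < real (Suc (m b)) / real q"
      using that by (auto simp: mem_interior_grid_cell)
    then have "real (m b) < real q * (x \<bullet> b)" "real q * (x \<bullet> b) < real (m b) + 1"
      using assms by (simp_all add: field_simps)
    then show ?thesis by linarith
  qed
  have "k b = l b" if "b \<in> Basis" for b
    using index[of k b] index[of l b] x that by simp
  with kl show False by (meson PiE_ext)
qed

lemma unit_cube_subset_Union_grid_cell:
  assumes "q \<ge> 1"
  shows "cbox 0 One \<subseteq> (\<Union>k\<in>Basis \<rightarrow>\<^sub>E {..<q}. grid_cell q k)"
proof
  fix x :: 'a assume x: "x \<in> cbox 0 One"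
  \<comment> \<open>The minimum puts the points with a coordinate 1 into the last cell of that row.\<close>
  define k where "k = (\<lambda>b\<in>Basis. min (q - 1) (nat \<lfloor>real q * (x \<bullet> b)\<rfloor>))"
  have "real (k b) \<le> real q * (x \<bullet> b) \<and> real q * (x \<bullet> b) \<le> real (Suc (k b)) \<and> k b < q"
    if "b \<in> Basis" for b
  proof -
    have "0 \<le> real q * (x \<bullet> b)" "real q * (x \<bullet> b) \<le> real q"
      using x that by (auto simp: mem_box mult_left_le)
    moreover have "k b = min (q - 1) (nat \<lfloor>real q * (x \<bullet> b)\<rfloor>)"
      using that by (simp add: k_def)
    ultimately show ?thesis using assms by linarith
  qed
  then have "x \<in> grid_cell q k" "k \<in> Basis \<rightarrow>\<^sub>E {..<q}"
    using assms by (auto simp: mem_grid_cell field_simps k_def)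
  then show "x \<in> (\<Union>k\<in>Basis \<rightarrow>\<^sub>E {..<q}. grid_cell q k)" by blast
qed

lemma grid_cell_subset_unit_cube:
  assumes "k \<in> Basis \<rightarrow>\<^sub>E {..<q}"
  shows "grid_cell q k \<subseteq> cbox 0 One"
proof
  fix x assume x: "x \<in> grid_cell q k"
  have "0 \<le> x \<bullet> b \<and> x \<bullet> b \<le> 1" if b: "b \<in> Basis" for b
  proof -
    have "k b < q" using assms b by auto
    then have "real (Suc (k b)) / real q \<le> 1" "0 \<le> real (k b) / real q" by simp_all
    moreover have "real (k b) / real q \<le> x \<bullet> b" "x \<bullet> b \<le> real (Suc (k b)) / real q"
      using x b by (simp_all add: mem_grid_cell)
    ultimately show ?thesis by linarith
  qed
  then show "x \<in> cbox 0 One" by (simp add: mem_box)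
qed

lemma dist_grid_cell_le:
  fixes x y :: "'a::euclidean_space"
  assumes "x \<in> grid_cell q k" "y \<in> grid_cell q k"
  shows "dist x y \<le> DIM('a) / real q"
proof -
  have "dist x y \<le> (\<Sum>b\<in>Basis. \<bar>(x - y) \<bullet> b\<bar>)" unfolding dist_norm by (rule norm_le_l1)
  also have "\<dots> \<le> (\<Sum>b\<in>(Basis :: 'a set). 1 / real q)"
  proof (rule sum_mono)
    fix b :: 'a assume "b \<in> Basis"
    with assms have "real (k b) / q \<le> x \<bullet> b" "x \<bullet> b \<le> real (k b) / q + 1 / q"
        "real (k b) / q \<le> y \<bullet> b" "y \<bullet> b \<le> real (k b) / q + 1 / q"
      by (auto simp: mem_grid_cell add_divide_distrib)
    then show "\<bar>(x - y) \<bullet> b\<bar> \<le> 1 / real q" by (simp add: inner_diff_left)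
  qed
  finally show ?thesis by simp
qed

lemma bounded_grid_cell: "bounded (grid_cell q k)"
  by (simp add: grid_cell_def)

lemma diameter_grid_cell_le: "diameter (grid_cell q k :: 'a::euclidean_space set) \<le> DIM('a) / real q"
  by (intro diameter_le) (auto simp: dist_grid_cell_le simp flip: dist_norm)

lemma measure_Union_interior_grid_cell:
  assumes "q \<ge> 1" "finite K" "K \<subseteq> (Basis :: 'a::euclidean_space set) \<rightarrow>\<^sub>E UNIV"
  shows "measure lebesgue (\<Union>k\<in>K. interior (grid_cell q k)) = real (card K) / real q ^ DIM('a)"
proof -
  have "disjoint_family_on (\<lambda>k. interior (grid_cell q k)) K"
    using assms(3) disjoint_family_on_interior_grid_cell[OF assms(1)] by (rule disjoint_family_on_mono)
  with assms(2) have "measure lebesgue (\<Union>k\<in>K. interior (grid_cell q k))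
      = (\<Sum>k\<in>K. measure lebesgue (interior (grid_cell q k)))"
    by (intro measure_finite_Union) (auto simp: grid_cell_def emeasure_lborel_box_eq)
  then show ?thesis
    by (simp only: measure_interior_grid_cell) (simp add: power_one_over)
qed

lemma card_grid_cells_le_integral:
  fixes f :: "'a::euclidean_space \<Rightarrow> real"
  assumes "q \<ge> 1" and K: "K \<subseteq> Basis \<rightarrow>\<^sub>E {..<q}"
    and f: "integrable cube_measure f" "\<And>x. 0 \<le> f x" and "c > 0"
    and large: "\<And>k x. k \<in> K \<Longrightarrow> x \<in> grid_cell q k \<Longrightarrow> c \<le> f x"
  shows "real (card K) \<le> real q ^ DIM('a) * (\<integral>x. f x \<partial>cube_measure) / c"
proof -
  let ?U = "\<Union>k\<in>K. interior (grid_cell q k)"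
  have U_cube: "?U \<subseteq> cbox 0 One"
    using K grid_cell_subset_unit_cube interior_subset by blast
  have "finite K" "K \<subseteq> Basis \<rightarrow>\<^sub>E UNIV"
    using K by (auto intro: finite_subset simp: finite_PiE)
  moreover have "?U \<in> sets lebesgue"
    by (rule sets_completionI_sets) (simp add: borel_open open_UN)
  ultimately have "real (card K) / real q ^ DIM('a) = measure cube_measure ?U"
    using measure_Union_interior_grid_cell[OF \<open>q \<ge> 1\<close>, of K] U_cube by (simp add: measure_cube_measure)
  also have "\<dots> \<le> measure cube_measure {x \<in> space cube_measure. c \<le> f x}"
  proof (rule cube_measure.finite_measure_mono)
    show "?U \<subseteq> {x \<in> space cube_measure. c \<le> f x}"
      using U_cube large interior_subset by (simp add: subset_iff) blast
    show "{x \<in> space cube_measure. c \<le> f x} \<in> sets cube_measure"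
      using f(1) by measurable
  qed
  also have "\<dots> \<le> (\<integral>x. f x \<partial>cube_measure) / c"
    using f \<open>c > 0\<close> by (intro integral_Markov_inequality_measure[where A = "{}"]) auto
  finally show ?thesis using \<open>q \<ge> 1\<close> by (simp add: field_simps)
qed

lemma norm_ge_half_on_grid_cell:
  fixes f :: "'a::euclidean_space \<Rightarrow> 'b::real_normed_vector"
  assumes lipschitz: "L-lipschitz_on (cbox 0 One) f" and fine: "L * (DIM('a) / real q) \<le> \<alpha> / 2"
    and k: "k \<in> Basis \<rightarrow>\<^sub>E {..<q}" and x: "x \<in> grid_cell q k"
    and y: "y \<in> grid_cell q k" "\<alpha> \<le> norm (f y)"
  shows "\<alpha> / 2 \<le> norm (f x)"
proof -
  have "dist (f y) (f x) \<le> L * dist y x"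
    using grid_cell_subset_unit_cube[OF k] x y(1) by (intro lipschitz_onD[OF lipschitz]) auto
  also have "\<dots> \<le> L * (DIM('a) / real q)"
    using dist_grid_cell_le[OF y(1) x] lipschitz_on_nonneg[OF lipschitz] by (rule mult_left_mono)
  also have "\<dots> \<le> \<alpha> / 2" by (rule fine)
  finally show ?thesis using y(2) norm_triangle_ineq2[of "f y" "f x"] by (simp add: dist_norm)
qed

lemma hausdorff_premeasure_superlevel_le_grid:
  fixes f :: "'a::euclidean_space \<Rightarrow> 'b::real_normed_vector"
  assumes lipschitz: "L-lipschitz_on (cbox 0 One) f"
    and q: "q \<ge> 1" "L * (DIM('a) / real q) \<le> \<alpha> / 2" "DIM('a) / real q \<le> \<delta>"
    and "\<alpha> > 0" "s \<ge> 0"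
  shows "hausdorff_premeasure s \<delta> {x \<in> cbox 0 One. \<alpha> \<le> norm (f x)}
    \<le> ennreal (4 * real q ^ DIM('a) * (\<integral>x. (norm (f x))\<^sup>2 \<partial>cube_measure) / \<alpha>\<^sup>2
      * (DIM('a) / real q) powr s)"
proof -
  define K where "K = {k \<in> Basis \<rightarrow>\<^sub>E {..<q}. \<exists>x\<in>grid_cell q k. \<alpha> \<le> norm (f x)}"
  have "finite K" unfolding K_def by (simp add: finite_PiE)
  have half: "\<alpha> / 2 \<le> norm (f x)" if "k \<in> K" "x \<in> grid_cell q k" for k x
    using that norm_ge_half_on_grid_cell[OF lipschitz q(2)] by (auto simp: K_def)
  have card_K: "real (card K) \<le> real q ^ DIM('a) * (\<integral>x. (norm (f x))\<^sup>2 \<partial>cube_measure) / (\<alpha> / 2)\<^sup>2"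
  proof (rule card_grid_cells_le_integral[OF q(1)])
    show "integrable cube_measure (\<lambda>x. (norm (f x))\<^sup>2)"
      using lipschitz_on_continuous_on[OF lipschitz]
      by (intro continuous_imp_integrable continuous_intros)
    show "(\<alpha> / 2)\<^sup>2 \<le> (norm (f x))\<^sup>2" if "k \<in> K" "x \<in> grid_cell q k" for k x
      using half[OF that] \<open>\<alpha> > 0\<close> by (intro power_mono) auto
  qed (use \<open>\<alpha> > 0\<close> in \<open>auto simp: K_def\<close>)
  have "{x \<in> cbox 0 One. \<alpha> \<le> norm (f x)} \<subseteq> (\<Union>k\<in>K. grid_cell q k)"
    using unit_cube_subset_Union_grid_cell[OF q(1), where 'a = 'a] by (fastforce simp: K_def)
  then have "hausdorff_premeasure s \<delta> {x \<in> cbox 0 One. \<alpha> \<le> norm (f x)}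
      \<le> ennreal (real (card K) * (DIM('a) / real q) powr s)"
    using \<open>finite K\<close> q \<open>s \<ge> 0\<close>
    by (intro hausdorff_premeasure_le_finite_cover) (auto simp: bounded_grid_cell diameter_grid_cell_le)
  also have "\<dots> \<le> ennreal (4 * real q ^ DIM('a) * (\<integral>x. (norm (f x))\<^sup>2 \<partial>cube_measure) / \<alpha>\<^sup>2
      * (DIM('a) / real q) powr s)"
    using card_K by (intro ennreal_leI mult_right_mono) (simp_all add: power_divide mult_ac)
  finally show ?thesis .
qed

theorem hausdorff_premeasure_superlevel_le:
  fixes f :: "'a::euclidean_space \<Rightarrow> 'b::real_normed_vector" and R :: real
  assumes lipschitz: "L-lipschitz_on (cbox 0 One) f"
    and R: "R \<ge> 1" "2 * L * real DIM('a) \<le> \<alpha> * R" "DIM('a) / R \<le> \<delta>"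
    and "\<alpha> > 0" "s \<ge> 0"
  shows "hausdorff_premeasure s \<delta> {x \<in> cbox 0 One. \<alpha> \<le> norm (f x)}
    \<le> ennreal (4 * (2 * R) ^ DIM('a) * (\<integral>x. (norm (f x))\<^sup>2 \<partial>cube_measure) / \<alpha>\<^sup>2 * (DIM('a) / R) powr s)"
proof -
  define q where "q = nat \<lceil>R\<rceil>"
  have q: "q \<ge> 1" "R \<le> real q" "real q \<le> 2 * R"
    using R(1) unfolding q_def by linarith+
  have "2 * L * real DIM('a) \<le> \<alpha> * real q"
    using R(2) mult_left_mono[OF q(2), of \<alpha>] \<open>\<alpha> > 0\<close> by linarith
  then have "L * (DIM('a) / real q) \<le> \<alpha> / 2"
    using q(1) by (simp add: field_simps)
  moreover have diam: "DIM('a) / real q \<le> DIM('a) / R"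
    using q R(1) by (intro divide_left_mono) auto
  ultimately have "hausdorff_premeasure s \<delta> {x \<in> cbox 0 One. \<alpha> \<le> norm (f x)}
      \<le> ennreal (4 * real q ^ DIM('a) * (\<integral>x. (norm (f x))\<^sup>2 \<partial>cube_measure) / \<alpha>\<^sup>2
      * (DIM('a) / real q) powr s)"
    using R(3)
    by (intro hausdorff_premeasure_superlevel_le_grid[OF lipschitz q(1) _ _ \<open>\<alpha> > 0\<close> \<open>s \<ge> 0\<close>]) auto
  also have "\<dots> \<le> ennreal (4 * (2 * R) ^ DIM('a) * (\<integral>x. (norm (f x))\<^sup>2 \<partial>cube_measure) / \<alpha>\<^sup>2
      * (DIM('a) / R) powr s)"
    using q(3) diam \<open>s \<ge> 0\<close>
    by (intro ennreal_leI mult_mono divide_right_mono power_mono powr_mono2) auto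
  finally show ?thesis .
qed

subsection \<open>Large Weyl means\<close>

definition weyl_mean :: "(nat \<Rightarrow> 'a::euclidean_space) \<Rightarrow> nat \<Rightarrow> 'a \<Rightarrow> complex" where
  "weyl_mean v N x = cesaro_mean (\<lambda>n. character (v n) x) N"

definition large_weyl_mean_set :: "(nat \<Rightarrow> 'a::euclidean_space) \<Rightarrow> real \<Rightarrow> nat \<Rightarrow> 'a set" where
  "large_weyl_mean_set v \<epsilon> N = {x \<in> cbox 0 One. \<epsilon> \<le> norm (weyl_mean v N x)}"

lemma lipschitz_on_weyl_mean:
  "(2 * pi * cesaro_mean (\<lambda>n. norm (v n)) N)-lipschitz_on S (weyl_mean v N)"
proof -
  have "(\<Sum>n=1..N. 2 * pi * norm (v n))-lipschitz_on S (\<lambda>x. \<Sum>n=1..N. character (v n) x)"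
    by (induction N) (auto intro!: lipschitz_intros lipschitz_on_character simp: add.commute)
  then have "(inverse (real N) * (\<Sum>n=1..N. 2 * pi * norm (v n)))-lipschitz_on S
      (\<lambda>x. (\<Sum>n=1..N. character (v n) x) /\<^sub>R real N)"
    by (intro lipschitz_intros) auto
  then show ?thesis
    by (simp add: weyl_mean_def[abs_def] cesaro_mean_def sum_distrib_left mult_ac)
qed

lemma integral_norm_weyl_mean_squared:
  fixes v :: "nat \<Rightarrow> 'a::euclidean_space"
  assumes "N \<ge> 1" "inj_on v {1..N}" "\<And>n. n \<in> {1..N} \<Longrightarrow> integer_vec (v n)"
  shows "(\<integral>x. (norm (weyl_mean v N x))\<^sup>2 \<partial>cube_measure) = 1 / real N"
proof -
  have "(\<integral>x. (norm (weyl_mean v N x))\<^sup>2 \<partial>cube_measure) = (\<Sum>n=1..N. (norm (1 / of_nat N :: complex))\<^sup>2)"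
    using parseval_characters[of "{1..N}" v "\<lambda>_. 1 / of_nat N"] assms(2,3)
    by (simp add: weyl_mean_def cesaro_mean_def scaleR_conv_of_real sum_distrib_left divide_inverse)
  then show ?thesis
    using assms(1) by (simp add: norm_divide power2_eq_square)
qed

lemma ex_power_summable_powr:
  assumes "e < 0"
  obtains M :: nat where "M \<ge> 1" "summable (\<lambda>k. real (k ^ M) powr e)"
proof -
  obtain M :: nat where M: "- 1 / e < real M" using reals_Archimedean2 by blast
  have "- 1 / e > 0" using assms by (simp add: divide_simps)
  with M have "M \<ge> 1" by (cases M) auto
  have "real M * e < - 1" using M assms by (simp add: field_simps)
  have "real (k ^ M) powr e = real k powr (real M * e)" for k
    using \<open>M \<ge> 1\<close> by (cases "k = 0") (auto simp: powr_powr simp flip: powr_realpow)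
  with \<open>real M * e < - 1\<close> have "summable (\<lambda>k. real (k ^ M) powr e)"
    by (simp add: summable_real_powr_iff)
  with \<open>M \<ge> 1\<close> show ?thesis by (rule that)
qed

context
  fixes v :: "nat \<Rightarrow> 'a::euclidean_space" and C \<tau> s :: real
  assumes integer: "\<And>n. n \<ge> 1 \<Longrightarrow> integer_vec (v n)" and inj: "inj_on v {1..}"
    and growth: "\<And>N. N \<ge> 1 \<Longrightarrow> cesaro_mean (\<lambda>n. norm (v n)) N \<le> C * real N powr \<tau>"
    and tau_pos: "\<tau> > 0" and s_nonneg: "s \<ge> 0"
begin

lemma hausdorff_premeasure_large_weyl_mean_set_le:
  fixes N :: nat and D \<epsilon> \<delta> :: real
  assumes "N \<ge> 1" "\<epsilon> > 0" "D \<ge> 1" and D_large: "4 * pi * C * real DIM('a) \<le> \<epsilon> * D"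
    and mesh: "DIM('a) / (D * real N powr \<tau>) \<le> \<delta>"
  shows "hausdorff_premeasure s \<delta> (large_weyl_mean_set v \<epsilon> N)
    \<le> ennreal (4 * (2 * D) ^ DIM('a) * (DIM('a) / D) powr s / \<epsilon>\<^sup>2 * real N powr (\<tau> * (DIM('a) - s) - 1))"
proof -
  let ?d = "real DIM('a)" and ?R = "D * real N powr \<tau>"
  have "?R \<ge> 1"
    using mult_mono[OF \<open>D \<ge> 1\<close>, of 1 "real N powr \<tau>"] assms(1,3) tau_pos
    by (simp add: ge_one_powr_ge_zero)
  have "2 * (2 * pi * cesaro_mean (\<lambda>n. norm (v n)) N) * ?d
      = 4 * pi * ?d * cesaro_mean (\<lambda>n. norm (v n)) N"
    by simp
  also have "\<dots> \<le> 4 * pi * ?d * (C * real N powr \<tau>)"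
    using growth[OF \<open>N \<ge> 1\<close>] by (intro mult_left_mono) auto
  also have "\<dots> = 4 * pi * C * ?d * real N powr \<tau>" by simp
  also have "\<dots> \<le> \<epsilon> * D * real N powr \<tau>"
    using D_large by (rule mult_right_mono) simp
  finally have "2 * (2 * pi * cesaro_mean (\<lambda>n. norm (v n)) N) * ?d \<le> \<epsilon> * ?R" by (simp add: mult.assoc)
  then have "hausdorff_premeasure s \<delta> (large_weyl_mean_set v \<epsilon> N)
      \<le> ennreal (4 * (2 * ?R) ^ DIM('a) * (\<integral>x. (norm (weyl_mean v N x))\<^sup>2 \<partial>cube_measure) / \<epsilon>\<^sup>2
        * (?d / ?R) powr s)"
    unfolding large_weyl_mean_set_def
    by (intro hausdorff_premeasure_superlevel_le[OF lipschitz_on_weyl_mean]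
        \<open>?R \<ge> 1\<close> \<open>\<epsilon> > 0\<close> s_nonneg mesh)
  also have "(\<integral>x. (norm (weyl_mean v N x))\<^sup>2 \<partial>cube_measure) = real N powr (- 1)"
    using \<open>N \<ge> 1\<close> integer inj
    by (subst integral_norm_weyl_mean_squared) (auto intro: inj_on_subset simp: powr_minus_divide)
  also have "(2 * ?R) ^ DIM('a) = (2 * D) ^ DIM('a) * real N powr (\<tau> * ?d)"
    using \<open>N \<ge> 1\<close> by (simp add: power_mult_distrib powr_power mult.commute[of \<tau>])
  also have "(?d / ?R) powr s = (?d / D) powr s * real N powr (- \<tau> * s)"
    using \<open>D \<ge> 1\<close> by (simp add: powr_divide powr_mult powr_powr powr_minus divide_simps)
  also have "4 * ((2 * D) ^ DIM('a) * real N powr (\<tau> * ?d)) * real N powr (- 1) / \<epsilon>\<^sup>2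
        * ((?d / D) powr s * real N powr (- \<tau> * s))
      = 4 * (2 * D) ^ DIM('a) * (?d / D) powr s / \<epsilon>\<^sup>2
        * (real N powr (\<tau> * ?d) * real N powr (- \<tau> * s) * real N powr (- 1))"
    by (simp only: times_divide_eq_left times_divide_eq_right mult_ac)
  also have "real N powr (\<tau> * ?d) * real N powr (- \<tau> * s) * real N powr (- 1)
      = real N powr (\<tau> * (?d - s) - 1)"
    by (simp only: flip: powr_add) (simp add: algebra_simps)
  finally show ?thesis .
qed

lemma eventually_hausdorff_premeasure_large_weyl_mean_set_le:
  assumes "\<epsilon> > 0"
  obtains c where "c \<ge> 0"
    "\<And>\<delta>. \<delta> > 0 \<Longrightarrow> \<forall>\<^sub>F N in sequentially. hausdorff_premeasure s \<delta> (large_weyl_mean_set v \<epsilon> N)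
        \<le> ennreal (c * real N powr (\<tau> * (DIM('a) - s) - 1))"
proof
  let ?d = "real DIM('a)"
  define D where "D = max 1 (4 * pi * C * ?d / \<epsilon>)"
  have "D \<ge> 1" and D_large: "4 * pi * C * ?d \<le> \<epsilon> * D"
    using \<open>\<epsilon> > 0\<close> by (auto simp: D_def max_def field_simps)
  let ?c = "4 * (2 * D) ^ DIM('a) * (?d / D) powr s / \<epsilon>\<^sup>2"
  show "?c \<ge> 0" using \<open>D \<ge> 1\<close> by simp
  fix \<delta> :: real assume "\<delta> > 0"
  have "(\<lambda>N. ?d / D * real N powr (- \<tau>)) \<longlonglongrightarrow> ?d / D * 0"
    using tau_pos by (intro tendsto_mult tendsto_const tendsto_neg_powr filterlim_real_sequentially) auto
  then have "\<forall>\<^sub>F N in sequentially. ?d / D * real N powr (- \<tau>) < \<delta>"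
    using \<open>\<delta> > 0\<close> by (intro order_tendstoD) auto
  then show "\<forall>\<^sub>F N in sequentially. hausdorff_premeasure s \<delta> (large_weyl_mean_set v \<epsilon> N)
        \<le> ennreal (?c * real N powr (\<tau> * (?d - s) - 1))"
    using eventually_ge_at_top[of 1]
  proof eventually_elim
    case (elim N)
    then have "?d / (D * real N powr \<tau>) \<le> \<delta>" by (simp add: powr_minus field_simps)
    with elim(2) show ?case
      by (intro hausdorff_premeasure_large_weyl_mean_set_le \<open>\<epsilon> > 0\<close> \<open>D \<ge> 1\<close> D_large)
  qed
qed

lemma hausdorff_measure_limsup_large_weyl_mean_set_eq_0:
  assumes "\<epsilon> > 0" and mono: "strict_mono p"
    and summable: "summable (\<lambda>k. real (p k) powr (\<tau> * (DIM('a) - s) - 1))"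
  shows "hausdorff_measure s {x. \<exists>\<^sub>F k in sequentially. x \<in> large_weyl_mean_set v \<epsilon> (p k)} = 0"
proof -
  obtain c where "c \<ge> 0" and premeasure_le: "\<And>\<delta>. \<delta> > 0 \<Longrightarrow> \<forall>\<^sub>F N in sequentially.
      hausdorff_premeasure s \<delta> (large_weyl_mean_set v \<epsilon> N)
        \<le> ennreal (c * real N powr (\<tau> * (DIM('a) - s) - 1))"
    using eventually_hausdorff_premeasure_large_weyl_mean_set_le[OF \<open>\<epsilon> > 0\<close>] by blast
  show ?thesis
    using \<open>c \<ge> 0\<close> eventually_compose_filterlim[OF premeasure_le filterlim_subseq[OF mono]]
    by (intro hausdorff_measure_limsup_eq_0[OF summable_mult[OF summable, of c]]) auto
qed

theorem hausdorff_measure_weyl_mean_not_tendsto_0: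
  assumes "DIM('a) - 1 / \<tau> < s"
  shows "hausdorff_measure s {x \<in> cbox 0 One. \<not> (\<lambda>N. weyl_mean v N x) \<longlonglongrightarrow> 0} = 0"
proof -
  have "\<tau> * (DIM('a) - s) - 1 < 0" using assms tau_pos by (simp add: field_simps)
  then obtain M :: nat where "M \<ge> 1"
    and summable: "summable (\<lambda>k. real (k ^ M) powr (\<tau> * (DIM('a) - s) - 1))"
    by (rule ex_power_summable_powr)
  let ?B = "\<lambda>j k. large_weyl_mean_set v (inverse (real (Suc j))) (k ^ M)"
  have "hausdorff_measure s (\<Union>j. {x. \<exists>\<^sub>F k in sequentially. x \<in> ?B j k}) = 0"
    using strict_mono_power_nat[OF \<open>M \<ge> 1\<close>] summable
    by (intro hausdorff_measure_Union_sequence_eq_0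
        hausdorff_measure_limsup_large_weyl_mean_set_eq_0) auto
  moreover have "{x \<in> cbox 0 One. \<not> (\<lambda>N. weyl_mean v N x) \<longlonglongrightarrow> 0}
      \<subseteq> (\<Union>j. {x. \<exists>\<^sub>F k in sequentially. x \<in> ?B j k})"
  proof (rule subsetI, rule ccontr)
    fix x assume x: "x \<in> {x \<in> cbox 0 One. \<not> (\<lambda>N. weyl_mean v N x) \<longlonglongrightarrow> 0}"
      and "x \<notin> (\<Union>j. {x. \<exists>\<^sub>F k in sequentially. x \<in> ?B j k})"
    then have rare: "\<forall>\<^sub>F k in sequentially. x \<notin> ?B j k" for j by (simp add: not_frequently)
    have "(\<lambda>k. weyl_mean v (k ^ M) x) \<longlonglongrightarrow> 0"
      unfolding tendsto_iff
    proof (intro allI impI)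
      fix e :: real assume "e > 0"
      then obtain j where j: "inverse (real (Suc j)) < e" using reals_Archimedean by blast
      show "\<forall>\<^sub>F k in sequentially. dist (weyl_mean v (k ^ M) x) 0 < e"
        using rare[of j] by eventually_elim (use x j in \<open>simp add: large_weyl_mean_set_def not_le\<close>)
    qed
    then have "(\<lambda>N. weyl_mean v N x) \<longlonglongrightarrow> 0"
      unfolding weyl_mean_def using \<open>M \<ge> 1\<close>
      by (intro cesaro_mean_tendsto_0_along_powers[where B = 1]) auto
    with x show False by simp
  qed
  ultimately show ?thesis by (rule hausdorff_measure_eq_0_subset)
qed

end

subsection \<open>Matrix sequences\<close>

lemma norm_vector_matrix_mult_le_row_opnorm:
  fixes A :: "real ^ 'n ^ 'm"
  shows "norm (x v* A) \<le> row_opnorm A * norm x"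
proof (cases "x = 0")
  case False
  have "bounded_linear (\<lambda>x. x v* A)"
    using matrix_vector_mul_bounded_linear[of "transpose A"]
    by (rule back_subst[of bounded_linear]) (simp add: fun_eq_iff)
  then interpret bounded_linear "\<lambda>x. x v* A" .
  obtain K where K: "\<And>x. norm (x v* A) \<le> norm x * K"
    using bounded by blast
  have "bdd_above ((\<lambda>x. norm (x v* A)) ` {x. norm x = 1})"
    by (rule bdd_aboveI2[of _ _ K]) (metis K mem_Collect_eq mult_1)
  then have "norm ((x /\<^sub>R norm x) v* A) \<le> row_opnorm A"
    unfolding row_opnorm_def using False by (intro cSUP_upper) auto
  moreover have "(x /\<^sub>R norm x) v* A = (x v* A) /\<^sub>R norm x" by (rule scaleR)
  ultimately show ?thesis using False by (simp add: field_simps)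
qed simp

lemma row_opnorm_nonneg: "0 \<le> row_opnorm (A :: real ^ 'n ^ 'm)"
  using order_trans[OF norm_ge_zero norm_vector_matrix_mult_le_row_opnorm[of "axis undefined 1" A]]
  by simp

lemma norm_matrix_vector_mult_le_row_opnorm:
  fixes A :: "real ^ 'n ^ 'm"
  shows "norm (A *v h) \<le> row_opnorm A * norm h"
proof (cases "A *v h = 0")
  case False
  have "norm (A *v h) * norm (A *v h) = ((A *v h) v* A) \<bullet> h"
    by (simp add: dot_lmul_matrix flip: power2_norm_eq_inner power2_eq_square)
  also have "\<dots> \<le> norm ((A *v h) v* A) * norm h" by (rule norm_cauchy_schwarz)
  also have "\<dots> \<le> row_opnorm A * norm (A *v h) * norm h"
    by (intro mult_right_mono norm_vector_matrix_mult_le_row_opnorm) auto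
  finally show ?thesis using False by (simp add: mult_ac)
qed (simp add: row_opnorm_nonneg)

lemma cesaro_mean_norm_matrix_vector_mult_le:
  fixes A :: "nat \<Rightarrow> real ^ 'n ^ 'm"
  shows "cesaro_mean (\<lambda>n. norm (A n *v h)) N \<le> norm h * cesaro_mean (\<lambda>n. row_opnorm (A n)) N"
proof -
  have "cesaro_mean (\<lambda>n. norm (A n *v h)) N \<le> cesaro_mean (\<lambda>n. norm h * row_opnorm (A n)) N"
    by (intro cesaro_mean_mono)
      (simp add: norm_matrix_vector_mult_le_row_opnorm mult.commute[of "norm h"])
  also have "\<dots> = norm h * cesaro_mean (\<lambda>n. row_opnorm (A n)) N"
    by (rule linear_cesaro_mean[symmetric]) (rule linear_times)
  finally show ?thesis .
qed

lemma integer_vec_cart_iff: "integer_vec h \<longleftrightarrow> (\<forall>i. h $ i \<in> \<int>)" for h :: "real ^ 'n"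
  unfolding integer_vec_def by (rule Ball_Basis_vec_iff)

lemma countable_integer_vec: "countable {h :: real ^ 'n. integer_vec h}"
  unfolding integer_vec_cart_iff Ints_def by (intro countable_vector countable_image) simp

lemma integer_vec_matrix_vector_mult:
  fixes A :: "real ^ 'n ^ 'm"
  assumes "\<And>i j. A $ i $ j \<in> \<int>" "integer_vec h"
  shows "integer_vec (A *v h)"
  using assms by (auto simp: integer_vec_cart_iff matrix_vector_mult_def intro!: Ints_sum Ints_mult)

lemma inj_on_matrix_vector_mult_if_invertible_diff:
  fixes A :: "'i \<Rightarrow> real ^ 'n ^ 'n"
  assumes "\<And>m n. m \<in> S \<Longrightarrow> n \<in> S \<Longrightarrow> m \<noteq> n \<Longrightarrow> invertible (A m - A n)" and "h \<noteq> 0"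
  shows "inj_on (\<lambda>n. A n *v h) S"
proof (rule inj_onI, rule ccontr)
  fix m n assume "m \<in> S" "n \<in> S" "m \<noteq> n" and eq: "A m *v h = A n *v h"
  then have "inj ((*v) (A m - A n))"
    using assms(1) by (simp add: invertible_left_inverse matrix_left_invertible_injective)
  moreover have "(A m - A n) *v h = (A m - A n) *v 0"
    using eq by (simp add: matrix_vector_mult_diff_rdistrib)
  ultimately have "h = 0" by (rule injD)
  with \<open>h \<noteq> 0\<close> show False ..
qed

lemma character_vector_matrix_mult: "character h (x v* A) = character (A *v h) x"
  for A :: "real ^ 'n ^ 'm"
  by (simp add: character_def dot_lmul_matrix inner_commute[of h] inner_commute[of "A *v h"])

lemma exceptional_set_subset:
  fixes A :: "nat \<Rightarrow> real ^ 'n ^ 'n"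
  shows "exceptional_set A \<subseteq> (\<Union>h\<in>{h. integer_vec h} - {0}.
    {x \<in> cbox 0 One. \<not> (\<lambda>N. weyl_mean (\<lambda>n. A n *v h) N x) \<longlonglongrightarrow> 0})"
proof
  fix x assume "x \<in> exceptional_set A"
  then have x: "x \<in> cbox 0 One" and "\<not> uniformly_distributed_mod1 (\<lambda>n. x v* A n)"
    unfolding exceptional_set_def mem_Collect_eq mem_cbox_One_iff by blast+
  then have "\<not> weyl_means_vanish (\<lambda>n. x v* A n)"
    using weyl_criterion by blast
  then obtain h where "integer_vec h" "h \<noteq> 0" "\<not> (\<lambda>N. weyl_mean (\<lambda>n. A n *v h) N x) \<longlonglongrightarrow> 0"
    unfolding weyl_means_vanish_def weyl_mean_def character_vector_matrix_mult by blast
  with x show "x \<in> (\<Union>h\<in>{h. integer_vec h} - {0}.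
      {x \<in> cbox 0 One. \<not> (\<lambda>N. weyl_mean (\<lambda>n. A n *v h) N x) \<longlonglongrightarrow> 0})"
    by blast
qed

theorem theorem3p9:
  fixes A :: "nat \<Rightarrow> real ^ 'n ^ 'n" and \<tau> :: real
  assumes integer_entries: "\<And>n i j. n \<ge> 1 \<Longrightarrow> A n $ i $ j \<in> \<int>"
    and tau: "\<tau> \<ge> 1 / real CARD('n)"
    and growth: "\<exists>c>0. \<forall>N\<ge>1. (1 / real N) * (\<Sum>n=1..N. row_opnorm (A n)) \<le> c * real N powr \<tau>"
    and differences_invertible:
      "\<And>m n. m \<ge> 1 \<Longrightarrow> n \<ge> 1 \<Longrightarrow> n \<noteq> m \<Longrightarrow> invertible (A n - A m)"
  shows "hausdorff_dim (exceptional_set A) \<le> ereal (real CARD('n) - 1 / \<tau>)"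
proof (rule hausdorff_dim_leI)
  have "\<tau> > 0" using tau by (rule less_le_trans[rotated]) simp
  with tau show nonneg: "0 \<le> real CARD('n) - 1 / \<tau>" by (simp add: field_simps)
  obtain c where mean_growth: "\<And>N. N \<ge> 1 \<Longrightarrow> cesaro_mean (\<lambda>n. row_opnorm (A n)) N \<le> c * real N powr \<tau>"
    using growth by (auto simp: cesaro_mean_def divide_inverse)
  fix s assume s_large: "real CARD('n) - 1 / \<tau> < s"
  have "hausdorff_measure s {x \<in> cbox 0 One. \<not> (\<lambda>N. weyl_mean (\<lambda>n. A n *v h) N x) \<longlonglongrightarrow> 0} = 0"
    if "integer_vec h" "h \<noteq> 0" for h
  proof (rule hausdorff_measure_weyl_mean_not_tendsto_0[where C = "norm h * c"])
    show "integer_vec (A n *v h)" if "n \<ge> 1" for n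
      using integer_entries[OF that] \<open>integer_vec h\<close> by (rule integer_vec_matrix_vector_mult)
    show "inj_on (\<lambda>n. A n *v h) {1..}"
      using differences_invertible \<open>h \<noteq> 0\<close> by (intro inj_on_matrix_vector_mult_if_invertible_diff) auto
    show "cesaro_mean (\<lambda>n. norm (A n *v h)) N \<le> norm h * c * real N powr \<tau>" if "N \<ge> 1" for N
      using order_trans[OF cesaro_mean_norm_matrix_vector_mult_le
          mult_left_mono[OF mean_growth[OF that] norm_ge_zero]]
      by (simp add: mult.assoc)
  qed (use \<open>\<tau> > 0\<close> nonneg s_large in auto)
  then show "hausdorff_measure s (exceptional_set A) = 0"
    by (intro hausdorff_measure_eq_0_subset[OF hausdorff_measure_countable_Union_eq_0
            exceptional_set_subset]
        countable_Diff countable_integer_vec) simp_all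
qed

end
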